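(* Let $L\subset\mathbb{R}^{n+1}$ be an $n$-dimensional lattice and let $D$ be an $n$-dimensional Delaunay polytope of $L$ with circumcenter $c\in L\otimes\mathbb{R}$. For $i\in\mathbb{Z}$ let $D_i=D_L((1-2i)c)$ and let $r_i$ be the common distance between $(1-2i)c$ and the vertices of $D_i$. For $\delta\geq 0$ let $L(\delta)=L+\mathbb{Z}e_{n+1}$, where $e_{n+1}\in\mathbb{R}^{n+1}$ is such that $2c-e_{n+1}$ is orthogonal to $L\otimes\mathbb{R}$ and $\delta$ is the squared Euclidean distance between the layers $L$ and $L+e_{n+1}$, that is, $\|2c-e_{n+1}\|^2=\delta$. Then one of the following holds: (i) Either $r_i\geq r_0$ for all $i\in\mathbb{Z}$. Then $L(0)$ is an index $2$ superlattice of $L$ such that $D'=D_{L(0)}(c)$ is a centrally symmetric Delaunay $n$-polytope containing $D\cup(2c-D)$, with $\mathrm{perfrank}\,D'\leq\mathrm{perfrank}\,D$. (ii) Or there exists $i\in\mathbb{Z}$ such that $r_i<r_0$. Then there exists $\delta_s>0$ such that, with $c'=\frac12 e_{n+1}$ (where $e_{n+1}$ is the vector corresponding to $\delta=\delta_s$), $D'=D_{L(\delta_s)}(c')$ is a centrally symmetric Delaunay $(n+1)$-polytope containing $D\cup(2c'-D)$, with $\mathrm{perfrank}\,D'\leq\mathrm{perfrank}\,D$.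
   Context: For a lattice $L$, $L\otimes\mathbb{R}$ is its real linear span. A Delaunay polytope of $L$ is a polytope whose vertex set is $S\cap L$, where $S$ is a sphere in $L\otimes\mathbb{R}$ having no point of $L$ in its interior; the center of $S$ is the (circum)center of $D$. For $x\in L\otimes\mathbb{R}$, $$D_L(x)=\mathrm{conv}\Big\{v\in L : \|x-v\|=\min_{w\in L}\|x-w\|\Big\}$$ is the (not necessarily full-dimensional) Delaunay polytope of $L$ determined by $x$. Thus $D_0=D_L(c)=D$. A Delaunay polytope with circumcenter $c$ is centrally symmetric if its vertex set is invariant under $x\mapsto 2c-x$. A superlattice of $L$ is a lattice containing $L$; it has index $2$ if $L$ is a subgroup of index $2$ in it. The vector $e_{n+1}$ is determined by $\delta$ up to isometry (reflection in $L\otimes\mathbb{R}$). For $\delta=0$ one has $e_{n+1}=2c$. Perfection rank: for a full-dimensional Delaunay polytope $D$ of a lattice $L=\mathbb{Z}v_1+\dots+\mathbb{Z}v_n$ of rank $n$, let $C_D$ be the cone of quadratic functions (real polynomial functions $f$ of degree at most $2$ in $n$ variables) such that $f(x)\geq 0$ for all $x\in\mathbb{Z}^n$, and, for $x\in\mathbb{Z}^n$, $f(x)=0$ if and only if $\sum_{i=1}^n x_iv_i$ is a vertex of $D$. Then $\mathrm{perfrank}\,D$ is the dimension of the cone $C_D$.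
   Formalization: In (i), "index 2 superlattice" is false in general (index 1 for L=Z, D=[0,1]; index 3 can also occur); it is replaced by: L(0) is a rank n lattice containing L with finite index, and the index is 2 exactly when 2c is not in L and 4c is in L. *)

theory Defs
  imports "HOL-Analysis.Analysis" "HOL-Library.Function_Algebras"
begin

text \<open>A lattice need not have full rank in the ambient space; its real span plays the role of
  the tensor product with the reals.\<close>

definition lattice_basis :: "nat \<Rightarrow> (nat \<Rightarrow> 'a::euclidean_space) \<Rightarrow> 'a set \<Rightarrow> bool" where
  "lattice_basis n v L \<longleftrightarrow>
     inj_on v {..<n} \<and> independent (v ` {..<n}) \<and>
     L = {\<Sum>i<n. of_int (x i) *\<^sub>R v i | x :: nat \<Rightarrow> int. True}"

definition is_lattice :: "nat \<Rightarrow> 'a::euclidean_space set \<Rightarrow> bool" where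
  "is_lattice n L \<longleftrightarrow> (\<exists>v. lattice_basis n v L)"

text \<open>The group index of \<open>L\<close> in \<open>M\<close>, counted by cosets; it is \<open>0\<close> if the index is infinite.
  The index of \<open>L\<close> in \<open>L + \<int> 2c\<close> is the order of \<open>2c\<close> modulo \<open>L\<close>. That order can differ from 2 even if
  all \<open>r i \<ge> r 0\<close>: it is 1 whenever \<open>D\<close> is centrally symmetric, and it is 3 for the lattice of the integer
  vectors of length 4 whose sum is divisible by 3 and \<open>D\<close> the simplex on 0 and the vectors 1 - e_i.
  The theorem therefore claims that the index is finite, and says exactly when it is 2.\<close>

definition lattice_index :: "'a::euclidean_space set \<Rightarrow> 'a set \<Rightarrow> nat" where
  "lattice_index L M = card {(\<lambda>y. x + y) ` L | x. x \<in> M}"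

definition vertices :: "'a::euclidean_space set \<Rightarrow> 'a set" where
  "vertices D = {x. x extreme_point_of D}"

definition delaunay_polytope :: "'a::euclidean_space set \<Rightarrow> 'a \<Rightarrow> 'a set \<Rightarrow> bool" where
  "delaunay_polytope L c D \<longleftrightarrow>
     c \<in> span L \<and> polytope D \<and>
     (\<exists>r\<ge>0. ball c r \<inter> L = {} \<and> vertices D = sphere c r \<inter> L)"

definition delaunay_at :: "'a::euclidean_space set \<Rightarrow> 'a \<Rightarrow> 'a set" where
  "delaunay_at L x = convex hull {v \<in> L. \<forall>w\<in>L. dist x v \<le> dist x w}"

definition delaunay_radius :: "'a::euclidean_space set \<Rightarrow> 'a \<Rightarrow> real" where
  "delaunay_radius L x = (THE r. \<forall>v\<in>vertices (delaunay_at L x). dist x v = r)"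

definition centrally_symmetric :: "'a::euclidean_space \<Rightarrow> 'a set \<Rightarrow> bool" where
  "centrally_symmetric c D \<longleftrightarrow> (\<lambda>x. 2 *\<^sub>R c - x) ` vertices D = vertices D"

definition layered :: "'a::euclidean_space set \<Rightarrow> 'a \<Rightarrow> 'a set" where
  "layered L e = {x + of_int k *\<^sub>R e | x k. x \<in> L}"

definition lift_vector :: "'a::euclidean_space set \<Rightarrow> 'a \<Rightarrow> real \<Rightarrow> 'a \<Rightarrow> bool" where
  "lift_vector L c \<delta> e \<longleftrightarrow>
     (\<forall>x\<in>span L. orthogonal (2 *\<^sub>R c - e) x) \<and> (norm (2 *\<^sub>R c - e))\<^sup>2 = \<delta>"

text \<open>Polynomial functions of degree at most 2 in \<open>n\<close> variables. A point of \<open>n\<close>-space is given by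
  the first \<open>n\<close> values of a sequence; the functions below ignore the other values, so
  they form a vector space isomorphic to that of the quadratic functions on \<open>n\<close>-space.\<close>

definition quadratic_function :: "nat \<Rightarrow> ((nat \<Rightarrow> real) \<Rightarrow> real) \<Rightarrow> bool" where
  "quadratic_function n f \<longleftrightarrow>
     (\<exists>a b q. \<forall>x. f x = a + (\<Sum>i<n. b i * x i) + (\<Sum>i<n. \<Sum>j<n. q i j * x i * x j))"

definition perfection_cone ::
    "nat \<Rightarrow> (nat \<Rightarrow> 'a::euclidean_space) \<Rightarrow> 'a set \<Rightarrow> ((nat \<Rightarrow> real) \<Rightarrow> real) set" where
  "perfection_cone n v D =
     {f. quadratic_function n f \<and>
         (\<forall>x :: nat \<Rightarrow> int.
            f (\<lambda>i. of_int (x i)) \<ge> 0 \<and>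
            (f (\<lambda>i. of_int (x i)) = 0 \<longleftrightarrow> (\<Sum>i<n. of_int (x i) *\<^sub>R v i) \<in> vertices D))}"

lemma vector_space_functions:
  "vector_space (\<lambda>(a::real) (f :: 'b \<Rightarrow> real) x. a * f x)"
  by unfold_locales (auto simp: fun_eq_iff algebra_simps)

text \<open>The dimension of a convex cone is that of its linear span. The basis \<open>v\<close> of the lattice is an
  explicit argument; the value does not depend on it.\<close>

definition perfrank :: "nat \<Rightarrow> (nat \<Rightarrow> 'a::euclidean_space) \<Rightarrow> 'a set \<Rightarrow> nat" where
  "perfrank n v D = vector_space.dim (\<lambda>a f x. a * f x) (perfection_cone n v D)"

end

theory Submission
  imports Defs
begin

text \<open>
  All layers of \<open>L + \<int>e\<close> are compared with the point \<open>c' = e/2\<close>. Since \<open>2c - e\<close> is orthogonal to \<open>L\<close>,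
  the squared distance from \<open>c'\<close> to the layer \<open>L + ke\<close> is \<open>(r k)\<^sup>2 + (k - 1/2)\<^sup>2 \<delta>\<close> by Pythagoras
  (\<open>layered_distance\<close>). The layers 0 and 1 give the same value \<open>(r 0)\<^sup>2 + \<delta>/4\<close>, and no layer is nearer as soon
  as \<open>(r 0)\<^sup>2 \<le> (r k)\<^sup>2 + k(k - 1) \<delta>\<close> for all \<open>k\<close>. Then the vertices of \<open>D\<close> and their reflections
  \<open>e - u\<close> are among the nearest points of \<open>c'\<close>, which gives central symmetry and the
  inclusion of \<open>D\<close> and its reflection at once (\<open>layered_delaunay\<close>).

  If all \<open>r k \<ge> r 0\<close>, the inequality holds with \<open>\<delta> = 0\<close> and \<open>e = 2c\<close>. What has to be shown is that
  \<open>L + \<int> 2c\<close> is a lattice. The sphere of \<open>D\<close> contains no point of this group in its interior, so a short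
  element \<open>w\<close> of the group, added to or subtracted from a vertex \<open>u\<close>, must move almost tangentially to
  the sphere at \<open>u\<close>. The vertices affinely span the space, so \<open>w\<close> would be
  almost orthogonal to everything; this bounds \<open>norm w\<close> from below (\<open>layered_separated_from_zero\<close>). A pigeonhole
  argument then puts a multiple of \<open>2c\<close> into \<open>L\<close>, and a triangular basis can be chosen.

  Otherwise \<open>\<delta>\<close> is taken as the largest value of \<open>((r 0)\<^sup>2 - (r k)\<^sup>2) / (k(k - 1))\<close> over
  \<open>k\<close> other than 0 and 1, the squared height at which a third layer first touches the sphere while the lattice is compressed
  (\<open>critical_height_exists\<close>). The new contact point makes \<open>D'\<close> full-dimensional.

  For the ranks, the cone of \<open>D\<close> spans the space of all quadratic functions that vanish on
  the vertices of \<open>D\<close>: such a function is dominated on \<open>L\<close> by the power function of the sphere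
  and can be absorbed by it (\<open>perfection_cone_span\<close>). It therefore suffices that restriction from the span
  of the larger lattice to the span of \<open>L\<close> is injective on quadratic functions vanishing on the vertices of
  \<open>D'\<close>. For equal spans this is trivial. In the lifted case a function in the kernel
  vanishes on \<open>span L\<close> and on the reflected vertices in the layer 1, which leaves only the
  multiples of \<open>t(t - 1)\<close>, with \<open>t\<close> the coordinate along \<open>e\<close>; the contact point in a third layer kills those.
\<close>

section \<open>Lattices of arbitrary rank and their nearest points\<close>

lemma lattice_basis_mem:
  "lattice_basis n v L \<Longrightarrow> z \<in> L \<longleftrightarrow> (\<exists>x :: nat \<Rightarrow> int. z = (\<Sum>i<n. of_int (x i) *\<^sub>R v i))"
  unfolding lattice_basis_def by auto

lemma lattice_basis_vector:
  assumes "lattice_basis n v L" "i < n"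
  shows "v i \<in> L"
proof -
  have "(\<Sum>j<n. of_int (of_bool (j = i)) *\<^sub>R v j) = v i"
    using assms(2) by (simp add: of_bool_def if_distrib[of of_int] if_distrib[of "\<lambda>t. t *\<^sub>R _"] sum.delta cong: if_cong)
  then show ?thesis
    unfolding lattice_basis_mem[OF assms(1)] by metis
qed

lemma lattice_basis_span:
  assumes "lattice_basis n v L"
  shows "span L = span (v ` {..<n})"
proof (rule antisym)
  have "L \<subseteq> span (v ` {..<n})"
    using assms unfolding lattice_basis_def by (auto intro!: span_sum span_scale intro: span_base)
  then show "span L \<subseteq> span (v ` {..<n})"
    by (simp add: span_minimal)
  show "span (v ` {..<n}) \<subseteq> span L"
    using lattice_basis_vector[OF assms] by (intro span_mono) auto
qed

lemma lattice_basis_dim: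
  fixes L :: "'a::euclidean_space set"
  assumes "lattice_basis n v L"
  shows "dim L = n"
proof -
  have "dim L = dim (v ` {..<n})"
    by (metis dim_span lattice_basis_span[OF assms])
  also have "\<dots> = card (v ` {..<n})"
    using assms by (intro dim_eq_card_independent) (simp add: lattice_basis_def)
  also have "\<dots> = n"
    using assms by (simp add: lattice_basis_def card_image)
  finally show ?thesis .
qed

text \<open>The coordinate functionals \<open>\<kappa> i\<close> are defined on the whole space, not only on the span of the lattice. As
  linear maps on a Euclidean space they are bounded, which is what the finiteness and
  domination arguments use.\<close>

lemma lattice_basis_coordinates:
  fixes L :: "'a::euclidean_space set"
  assumes "lattice_basis n v L"
  obtains \<kappa> :: "nat \<Rightarrow> 'a \<Rightarrow> real"
  where "\<And>i. linear (\<kappa> i)"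
    and "\<And>(x :: nat \<Rightarrow> real) i. i < n \<Longrightarrow> \<kappa> i (\<Sum>j<n. x j *\<^sub>R v j) = x i"
    and "\<And>z. z \<in> span L \<Longrightarrow> (\<Sum>i<n. \<kappa> i z *\<^sub>R v i) = z"
proof -
  have inj: "inj_on v {..<n}" and ind: "independent (v ` {..<n})"
    using assms by (auto simp: lattice_basis_def)
  have "\<exists>g. linear g \<and> (\<forall>y\<in>v ` {..<n}. g y = (of_bool (y = v i) :: real))" for i
    using linear_independent_extend[OF ind, of "\<lambda>y. of_bool (y = v i)"] by simp
  then obtain \<kappa> where lin: "\<And>i. linear (\<kappa> i)"
    and dual: "\<And>i y. y \<in> v ` {..<n} \<Longrightarrow> \<kappa> i y = (of_bool (y = v i) :: real)"
    by metis
  have coord: "\<kappa> i (\<Sum>j<n. x j *\<^sub>R v j) = x i" if "i < n" for x :: "nat \<Rightarrow> real" and i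
  proof -
    have "\<kappa> i (\<Sum>j<n. x j *\<^sub>R v j) = (\<Sum>j<n. x j * \<kappa> i (v j))"
      by (simp add: linear_sum[OF lin] linear_cmul[OF lin])
    also have "\<dots> = (\<Sum>j<n. if j = i then x j else 0)"
      using that inj by (intro sum.cong) (auto simp: dual inj_on_eq_iff)
    finally show ?thesis
      using that by simp
  qed
  have "(\<Sum>i<n. \<kappa> i z *\<^sub>R v i) = z" if "z \<in> span L" for z
  proof -
    have "z \<in> span (v ` {..<n})"
      using that by (simp add: lattice_basis_span[OF assms])
    then obtain u where "z = (\<Sum>y\<in>v ` {..<n}. u y *\<^sub>R y)"
      by (auto simp: span_finite)
    then have z: "z = (\<Sum>j<n. u (v j) *\<^sub>R v j)"
      by (simp add: sum.reindex[OF inj])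
    show ?thesis
      unfolding z by (intro sum.cong) (auto simp: coord)
  qed
  with lin coord show ?thesis
    by (rule that)
qed

lemma lattice_basis_zero: "lattice_basis n v L \<Longrightarrow> 0 \<in> L"
  unfolding lattice_basis_def by (auto intro!: exI[of _ "\<lambda>_. 0"])

lemma lattice_basis_add:
  assumes "lattice_basis n v L" "x \<in> L" "y \<in> L"
  shows "x + y \<in> L"
proof -
  obtain a b :: "nat \<Rightarrow> int"
    where "x = (\<Sum>i<n. of_int (a i) *\<^sub>R v i)" "y = (\<Sum>i<n. of_int (b i) *\<^sub>R v i)"
    using assms by (auto simp: lattice_basis_mem)
  then have "x + y = (\<Sum>i<n. of_int (a i + b i) *\<^sub>R v i)"
    by (simp add: sum.distrib scaleR_left_distrib)
  then show ?thesis
    unfolding lattice_basis_mem[OF assms(1)] by (rule exI[of _ "\<lambda>i. a i + b i"])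
qed

lemma lattice_basis_of_int:
  assumes "lattice_basis n v L" "x \<in> L"
  shows "of_int k *\<^sub>R x \<in> L"
proof -
  obtain a :: "nat \<Rightarrow> int" where "x = (\<Sum>i<n. of_int (a i) *\<^sub>R v i)"
    using assms by (auto simp: lattice_basis_mem)
  then have "of_int k *\<^sub>R x = (\<Sum>i<n. of_int (k * a i) *\<^sub>R v i)"
    by (simp add: scaleR_sum_right)
  then show ?thesis
    unfolding lattice_basis_mem[OF assms(1)] by (rule exI[of _ "\<lambda>i. k * a i"])
qed

lemma lattice_basis_uminus: "lattice_basis n v L \<Longrightarrow> x \<in> L \<Longrightarrow> - x \<in> L"
  using lattice_basis_of_int[of n v L x "-1"] by simp

lemma lattice_basis_diff: "lattice_basis n v L \<Longrightarrow> x \<in> L \<Longrightarrow> y \<in> L \<Longrightarrow> x - y \<in> L"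
  using lattice_basis_add[of n v L x "- y"] lattice_basis_uminus by auto

text \<open>The coordinates of the points of a ball are bounded, and only finitely many integer vectors
  satisfy the bounds.\<close>

lemma lattice_finite_ball:
  fixes L :: "'a::euclidean_space set"
  assumes "lattice_basis n v L"
  shows "finite (L \<inter> cball a R)"
proof -
  obtain \<kappa> :: "nat \<Rightarrow> 'a \<Rightarrow> real" where lin: "\<And>i. linear (\<kappa> i)"
    and coord: "\<And>(x :: nat \<Rightarrow> real) i. i < n \<Longrightarrow> \<kappa> i (\<Sum>j<n. x j *\<^sub>R v j) = x i"
    by (rule lattice_basis_coordinates[OF assms]) (rule that)
  have "\<exists>B. \<forall>z\<in>cball a R. \<bar>\<kappa> i z\<bar> \<le> B" for i
  proof -
    have "bounded (\<kappa> i ` cball a R)"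
      using lin[of i] by (intro bounded_linear_image) (auto simp: linear_conv_bounded_linear)
    then show ?thesis
      by (auto simp: bounded_iff)
  qed
  then obtain B where B: "\<And>i z. z \<in> cball a R \<Longrightarrow> \<bar>\<kappa> i z\<bar> \<le> B i"
    by metis
  define box where "box = (\<Pi>\<^sub>E i\<in>{..<n}. {- \<lceil>B i\<rceil>..\<lceil>B i\<rceil>})"
  have "L \<inter> cball a R \<subseteq> (\<lambda>x. \<Sum>i<n. of_int (x i) *\<^sub>R v i) ` box"
  proof
    fix z assume z: "z \<in> L \<inter> cball a R"
    then obtain x where x: "z = (\<Sum>i<n. of_int (x i) *\<^sub>R v i)"
      using assms by (auto simp: lattice_basis_def)
    have "x i \<in> {- \<lceil>B i\<rceil>..\<lceil>B i\<rceil>}" if "i < n" for i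
    proof -
      have "\<bar>of_int (x i)\<bar> \<le> B i"
        using B[of z i] z coord[OF that, of "\<lambda>i. of_int (x i)"] by (simp add: x)
      then show ?thesis
        by (simp add: abs_le_iff) linarith
    qed
    then have "restrict x {..<n} \<in> box"
      by (auto simp: box_def)
    moreover have "z = (\<Sum>i<n. of_int (restrict x {..<n} i) *\<^sub>R v i)"
      unfolding x by (intro sum.cong) auto
    ultimately show "z \<in> (\<lambda>x. \<Sum>i<n. of_int (x i) *\<^sub>R v i) ` box"
      by blast
  qed
  moreover have "finite box"
    unfolding box_def by (intro finite_PiE) auto
  ultimately show ?thesis
    by (meson finite_imageI finite_subset)
qed

lemma lattice_closed:
  fixes L :: "'a::euclidean_space set"
  assumes "lattice_basis n v L"
  shows "closed L"
proof -
  have "closed (L \<inter> cball a 1)" for a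
    by (intro finite_imp_closed lattice_finite_ball[OF assms])
  show ?thesis
  proof (rule closed_sequential_limits[THEN iffD2], intro allI impI, elim conjE)
    fix s l assume s: "\<forall>n. s n \<in> L" "s \<longlonglongrightarrow> l"
    have "\<forall>\<^sub>F k in sequentially. s k \<in> L \<inter> cball l 1"
      using s tendstoD[OF s(2), of 1] by (auto elim!: eventually_mono simp: dist_commute)
    then have "l \<in> L \<inter> cball l 1"
      using \<open>closed (L \<inter> cball l 1)\<close> Lim_in_closed_set s(2) trivial_limit_sequentially by blast
    then show "l \<in> L"
      by simp
  qed
qed

section \<open>Delaunay polytopes as hulls of nearest points\<close>

text \<open>Spheres are strictly convex: inside a segment between two points of the ball, the distance to the centre is
  smaller than at one of the ends, so no point of the sphere is interior to such a segment.\<close>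

lemma vertices_convex_hull_cospherical:
  fixes S :: "'a::euclidean_space set"
  assumes "S \<subseteq> sphere c r"
  shows "vertices (convex hull S) = S"
proof -
  have "x extreme_point_of (convex hull S)" if "x \<in> S" for x
    unfolding extreme_point_of_def
  proof (intro conjI ballI notI)
    show "x \<in> convex hull S"
      using that by (simp add: hull_inc)
    fix a b assume ab: "a \<in> convex hull S" "b \<in> convex hull S" "x \<in> open_segment a b"
    have "convex hull S \<subseteq> cball c r"
      using assms by (intro hull_minimal) auto
    with ab dist_decreases_open_segment[OF ab(3), of c] that assms show False
      by (force simp: dist_commute)
  qed
  then show ?thesis
    using extreme_point_of_convex_hull[of _ S] by (auto simp: vertices_def)
qed

lemma delaunay_at_eq:
  assumes "ball x \<rho> \<inter> M = {}" "sphere x \<rho> \<inter> M \<noteq> {}"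
  shows "delaunay_at M x = convex hull (sphere x \<rho> \<inter> M)"
proof -
  obtain p where "p \<in> sphere x \<rho> \<inter> M"
    using assms(2) by blast
  then have p: "p \<in> M" "dist x p = \<rho>"
    by auto
  have far: "\<rho> \<le> dist x w" if "w \<in> M" for w
    using that assms(1) by (force simp: not_le[symmetric])
  have "{v \<in> M. \<forall>w\<in>M. dist x v \<le> dist x w} = sphere x \<rho> \<inter> M"
  proof (intro equalityI subsetI)
    fix y assume "y \<in> {v \<in> M. \<forall>w\<in>M. dist x v \<le> dist x w}"
    then show "y \<in> sphere x \<rho> \<inter> M"
      using p far[of y] by (auto intro: antisym)
  qed (auto simp: far)
  then show ?thesis
    by (simp add: delaunay_at_def)
qed

text \<open>The description of the radius as a common vertex distance is turned into the distance from a point to a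
  closed set, which is defined without choosing vertices.\<close>

lemma delaunay_radius_eq_infdist:
  fixes L :: "'a::euclidean_space set"
  assumes "lattice_basis n v L"
  shows "delaunay_radius L x = infdist x L"
    and "\<exists>p\<in>L. dist x p = infdist x L"
proof -
  have ne: "L \<noteq> {}"
    using lattice_basis_zero[OF assms] by auto
  obtain p where p: "p \<in> L" "infdist x L = dist x p"
    using infdist_attains_inf[OF lattice_closed[OF assms] ne] by blast
  then show "\<exists>p\<in>L. dist x p = infdist x L"
    by auto
  have b: "ball x (infdist x L) \<inter> L = {}"
    using infdist_le[of _ L x] by force
  have s: "sphere x (infdist x L) \<inter> L \<noteq> {}"
    using p by auto
  have "vertices (delaunay_at L x) = sphere x (infdist x L) \<inter> L"
    unfolding delaunay_at_eq[OF b s] by (rule vertices_convex_hull_cospherical) auto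
  then show "delaunay_radius L x = infdist x L"
    unfolding delaunay_radius_def using p by (auto intro!: the_equality)
qed

lemma delaunay_polytope_at:
  fixes M :: "'a::euclidean_space set"
  assumes "lattice_basis m w M" "x \<in> span M"
    and "ball x \<rho> \<inter> M = {}" "sphere x \<rho> \<inter> M \<noteq> {}"
  shows "delaunay_polytope M x (delaunay_at M x)"
    and "vertices (delaunay_at M x) = sphere x \<rho> \<inter> M"
proof -
  show v: "vertices (delaunay_at M x) = sphere x \<rho> \<inter> M"
    unfolding delaunay_at_eq[OF assms(3,4)] by (rule vertices_convex_hull_cospherical) auto
  have "finite (sphere x \<rho> \<inter> M)"
    by (rule finite_subset[OF _ lattice_finite_ball[OF assms(1), of x \<rho>]]) auto
  then have "polytope (delaunay_at M x)"
    unfolding delaunay_at_eq[OF assms(3,4)] polytope_def by blast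
  moreover have "\<rho> \<ge> 0"
    using assms(4) by auto
  ultimately show "delaunay_polytope M x (delaunay_at M x)"
    unfolding delaunay_polytope_def using v assms(2,3) by blast
qed

lemma polytope_convex_hull_vertices:
  "polytope D \<Longrightarrow> D = convex hull (vertices D)"
  unfolding vertices_def
  by (intro Krein_Milman_Minkowski polytope_imp_compact polytope_imp_convex)

section \<open>Perfection rank through restriction of quadratic functions\<close>

text \<open>Quadratic functions without reference to a basis, so that one function can be read in the coordinates
  of several lattices.\<close>

definition is_quadratic :: "('a::euclidean_space \<Rightarrow> real) \<Rightarrow> bool" where
  "is_quadratic F \<longleftrightarrow>
     (\<exists>\<alpha> l B. linear l \<and> bilinear B \<and> (\<forall>z. F z = \<alpha> + l z + B z z))"

text \<open>This lemma and the next translate between quadratic functions of integer coordinates and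
  quadratic functions on the ambient space, where two lattices with different bases can be compared.\<close>

lemma is_quadratic_compose_linear:
  assumes "quadratic_function m f" "\<And>i. linear (\<kappa> i)"
  shows "is_quadratic (\<lambda>z :: 'a::euclidean_space. f (\<lambda>i. \<kappa> i z))"
proof -
  obtain a b q where f: "\<And>x. f x = a + (\<Sum>i<m. b i * x i) + (\<Sum>i<m. \<Sum>j<m. q i j * x i * x j)"
    using assms(1) unfolding quadratic_function_def by blast
  define l where "l = (\<lambda>z. \<Sum>i<m. b i * \<kappa> i z)"
  define B where "B = (\<lambda>z y. \<Sum>i<m. \<Sum>j<m. q i j * \<kappa> i z * \<kappa> j y)"
  note lin = linear_add[OF assms(2)] linear_cmul[OF assms(2)]
  have "linear l"
    unfolding l_def by (intro linearI) (simp_all add: lin algebra_simps sum.distrib sum_distrib_left)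
  moreover have "bilinear B"
    unfolding bilinear_def B_def
    by (intro conjI allI linearI) (simp_all add: lin algebra_simps sum.distrib sum_distrib_left)
  ultimately show ?thesis
    unfolding is_quadratic_def
    by (intro exI[of _ a] exI[of _ l] exI[of _ B]) (auto simp: f l_def B_def)
qed

lemma quadratic_function_combination:
  assumes "is_quadratic F"
  shows "quadratic_function n (\<lambda>x. F (\<Sum>i<n. x i *\<^sub>R v i))"
proof -
  obtain \<alpha> l B where l: "linear l" and B: "bilinear B" and F: "\<And>z. F z = \<alpha> + l z + B z z"
    using assms by (auto simp: is_quadratic_def)
  have "F (\<Sum>i<n. x i *\<^sub>R v i) = \<alpha> + (\<Sum>i<n. l (v i) * x i) + (\<Sum>i<n. \<Sum>j<n. B (v i) (v j) * x i * x j)" for x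
    using l B
    by (simp add: F linear_sum linear_cmul bilinear_sum bilinear_lmul bilinear_rmul sum.cartesian_product
        mult_ac)
  then show ?thesis
    unfolding quadratic_function_def
    by (intro exI[of _ \<alpha>] exI[of _ "\<lambda>i. l (v i)"] exI[of _ "\<lambda>i j. B (v i) (v j)"]) auto
qed

lemma is_quadratic_bound:
  assumes "is_quadratic F"
  obtains K where "K > 0" "\<And>z. \<bar>F z\<bar> \<le> K * (1 + (norm z)\<^sup>2)"
proof -
  obtain \<alpha> l B where l: "linear l" and B: "bilinear B" and F: "\<And>z. F z = \<alpha> + l z + B z z"
    using assms by (auto simp: is_quadratic_def)
  obtain P where P: "P > 0" "\<And>z. norm (l z) \<le> P * norm z"
    using linear_bounded_pos[OF l] by blast
  obtain Q where Q: "Q > 0" "\<And>z y. norm (B z y) \<le> Q * norm z * norm y"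
    using bilinear_bounded_pos[OF B] by blast
  have "\<bar>F z\<bar> \<le> (\<bar>\<alpha>\<bar> + P + Q) * (1 + (norm z)\<^sup>2)" for z
  proof -
    \<comment> \<open>The linear term is absorbed by the other two: \<open>0 \<le> (norm z - 1/2)\<^sup>2\<close>.\<close>
    have "norm z \<le> 1 + (norm z)\<^sup>2"
      using zero_le_power2[of "norm z - 1/2"] by (simp add: power2_eq_square algebra_simps)
    then have "P * norm z \<le> P * (1 + (norm z)\<^sup>2)"
      using P by (intro mult_left_mono) auto
    moreover have "\<bar>F z\<bar> \<le> \<bar>\<alpha>\<bar> + P * norm z + Q * (norm z)\<^sup>2"
      using P(2)[of z] Q(2)[of z z] by (simp add: F power2_eq_square mult.assoc)
    moreover have "0 \<le> \<bar>\<alpha>\<bar> * (norm z)\<^sup>2"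
      by simp
    moreover have "(\<bar>\<alpha>\<bar> + P + Q) * (1 + (norm z)\<^sup>2)
        = \<bar>\<alpha>\<bar> + \<bar>\<alpha>\<bar> * (norm z)\<^sup>2 + P * (1 + (norm z)\<^sup>2) + Q + Q * (norm z)\<^sup>2"
      by (simp add: algebra_simps)
    ultimately show ?thesis
      using Q(1) by linarith
  qed
  then show ?thesis
    using P Q by (intro that[of "\<bar>\<alpha>\<bar> + P + Q"]) auto
qed

text \<open>The power of a point with respect to the circumsphere, \<open>(dist c z)\<^sup>2 - r\<^sup>2\<close>, is the basic member of the
  perfection cone.\<close>

lemma delaunay_power_function:
  assumes "delaunay_polytope L c D"
  shows "\<exists>r. \<forall>z\<in>L. (dist c z)\<^sup>2 \<ge> r\<^sup>2 \<and> ((dist c z)\<^sup>2 = r\<^sup>2 \<longleftrightarrow> z \<in> vertices D)"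
proof -
  obtain r where r: "r \<ge> 0" "ball c r \<inter> L = {}" "vertices D = sphere c r \<inter> L"
    using assms by (auto simp: delaunay_polytope_def)
  have "(dist c z)\<^sup>2 \<ge> r\<^sup>2" if "z \<in> L" for z
    using r that by (intro power_mono) (force simp: not_le[symmetric])+
  moreover have "(dist c z)\<^sup>2 = r\<^sup>2 \<longleftrightarrow> z \<in> vertices D" if "z \<in> L" for z
    using r that by (auto simp: power2_eq_iff_nonneg)
  ultimately show ?thesis
    by blast
qed

text \<open>Far from the centre the power function grows like \<open>(norm z)\<^sup>2\<close> and beats any quadratic function. The remaining
  lattice points are finitely many, and among them the power vanishes only where \<open>F\<close> does.\<close>

lemma is_quadratic_dominated:
  fixes L :: "'a::euclidean_space set"
  assumes "lattice_basis n v L" "is_quadratic F"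
    and power: "\<And>z. z \<in> L \<Longrightarrow> (dist c z)\<^sup>2 \<ge> r\<^sup>2"
    and F0: "\<And>z. z \<in> L \<Longrightarrow> (dist c z)\<^sup>2 = r\<^sup>2 \<Longrightarrow> F z = 0"
  obtains K where "K > 0" "\<And>z. z \<in> L \<Longrightarrow> \<bar>F z\<bar> \<le> K * ((dist c z)\<^sup>2 - r\<^sup>2)"
proof -
  obtain K where K: "K > 0" "\<And>z. \<bar>F z\<bar> \<le> K * (1 + (norm z)\<^sup>2)"
    using is_quadratic_bound[OF assms(2)] by blast
  \<comment> \<open>Beyond \<open>R\<close> the distance to \<open>c\<close> is at least \<open>(3/4) norm z + \<bar>r\<bar> + 1\<close>.\<close>
  define R where "R = 4 * norm c + 4 * \<bar>r\<bar> + 4"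
  define g where "g = (\<lambda>z. (dist c z)\<^sup>2 - r\<^sup>2)"
  have far: "1 + (norm z)\<^sup>2 \<le> 4 * g z" if "norm z > R" for z
  proof -
    have "norm z \<le> dist c z + norm c"
      by (metis dist_norm norm_minus_commute norm_triangle_sub add.commute)
    then have "(3/4) * norm z + \<bar>r\<bar> + 1 \<le> dist c z"
      using that by (simp add: R_def)
    then have "((3/4) * norm z + \<bar>r\<bar> + 1)\<^sup>2 \<le> (dist c z)\<^sup>2"
      by (intro power_mono) auto
    moreover have "((3/4) * norm z + \<bar>r\<bar> + 1)\<^sup>2 \<ge> (9/16) * (norm z)\<^sup>2 + r\<^sup>2 + 1"
    proof -
      have "((3/4) * norm z + \<bar>r\<bar> + 1)\<^sup>2 = (9/16) * (norm z)\<^sup>2 + r\<^sup>2 + 1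
          + (3/2) * (norm z * \<bar>r\<bar>) + (3/2) * norm z + 2 * \<bar>r\<bar>"
        by (simp add: power2_eq_square algebra_simps)
      then show ?thesis
        by simp
    qed
    ultimately have "(9/16) * (norm z)\<^sup>2 + 1 \<le> g z"
      unfolding g_def by linarith
    then show ?thesis
      using zero_le_power2[of "norm z"] by argo
  qed
  have fin: "finite (L \<inter> cball 0 R)"
    by (rule lattice_finite_ball[OF assms(1)])
  \<comment> \<open>Terms with \<open>g z = 0\<close> contribute \<open>x / 0 = 0\<close>; there \<open>F z = 0\<close> by assumption.\<close>
  define N where "N = (\<Sum>z\<in>L \<inter> cball 0 R. \<bar>F z\<bar> / g z)"
  have gpos: "g z \<ge> 0" if "z \<in> L" for z
    using power[OF that] by (simp add: g_def)
  have "\<bar>F z\<bar> \<le> (4 * K + N) * g z" if z: "z \<in> L" for z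
  proof (cases "norm z > R")
    case True
    have "\<bar>F z\<bar> \<le> K * (4 * g z)"
      using K(2)[of z] far[OF True] K(1) by (meson mult_left_mono less_imp_le order_trans)
    moreover have "0 \<le> N * g z"
      unfolding N_def by (intro mult_nonneg_nonneg sum_nonneg divide_nonneg_nonneg gpos z) auto
    ultimately show ?thesis
      by (simp add: algebra_simps)
  next
    case False
    show ?thesis
    proof (cases "g z = 0")
      case True
      then show ?thesis
        using F0[OF z] by (simp add: g_def)
    next
      case gz: False
      have "\<bar>F z\<bar> / g z \<le> N"
        unfolding N_def using z False fin gpos
        by (intro member_le_sum) auto
      then have "\<bar>F z\<bar> \<le> N * g z"
        using gz gpos[OF z] by (simp add: divide_simps split: if_splits)
      moreover have "0 \<le> 4 * K * g z"
        using K(1) gpos[OF z] by simp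
      ultimately show ?thesis
        by (simp add: algebra_simps)
    qed
  qed
  moreover have "N \<ge> 0"
    unfolding N_def using gpos by (intro sum_nonneg) auto
  ultimately show ?thesis
    using K(1) by (intro that[of "4 * K + N"]) (auto simp: g_def)
qed

interpretation fun_vs: vector_space "\<lambda>(a::real) (f :: 'b \<Rightarrow> real) x. a * f x"
  by (rule vector_space_functions)

text \<open>The space of all functions is infinite-dimensional, and an infinite basis would count as dimension 0. Comparing
  dimensions of spaces of quadratic functions therefore rests on the finitely many monomials of degree at most 2.\<close>

lemma quadratic_functions_finitely_generated:
  "\<exists>S. finite S \<and> {f. quadratic_function n f} \<subseteq> fun_vs.span S"
proof -
  define S :: "((nat \<Rightarrow> real) \<Rightarrow> real) set" where
    "S = insert (\<lambda>x. 1) ((\<lambda>i x. x i) ` {..<n} \<union> (\<lambda>(i, j) x. x i * x j) ` ({..<n} \<times> {..<n}))"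
  have "f \<in> fun_vs.span S" if quad: "quadratic_function n f" for f
  proof -
    obtain a b q where f: "\<And>x. f x = a + (\<Sum>i<n. b i * x i) + (\<Sum>i<n. \<Sum>j<n. q i j * x i * x j)"
      using quad unfolding quadratic_function_def by blast
    have sum: "(\<lambda>x. \<Sum>i\<in>A. g i x) = (\<Sum>i\<in>A. g i)" for A :: "nat set" and g :: "nat \<Rightarrow> 'c \<Rightarrow> real"
      by (induction A rule: infinite_finite_induct) (auto simp: fun_eq_iff)
    have "f = (\<lambda>x. a * 1) + (\<Sum>i<n. (\<lambda>x. b i * x i)) + (\<Sum>i<n. \<Sum>j<n. (\<lambda>x. q i j * (x i * x j)))"
      by (auto simp: fun_eq_iff f mult.assoc sum[symmetric])
    moreover have "\<dots> \<in> fun_vs.span S"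
    proof (intro fun_vs.span_add fun_vs.span_sum)
      show "(\<lambda>x. a * 1) \<in> fun_vs.span S"
        by (rule fun_vs.span_scale[of "\<lambda>x. 1"], rule fun_vs.span_base) (simp add: S_def)
      show "(\<lambda>x. b i * x i) \<in> fun_vs.span S" if "i \<in> {..<n}" for i
        by (rule fun_vs.span_scale[of "\<lambda>x. x i"], rule fun_vs.span_base) (use that in \<open>auto simp: S_def\<close>)
      show "(\<lambda>x. q i j * (x i * x j)) \<in> fun_vs.span S" if "i \<in> {..<n}" "j \<in> {..<n}" for i j
        by (rule fun_vs.span_scale[of "\<lambda>x. x i * x j"], rule fun_vs.span_base) (use that in \<open>auto simp: S_def\<close>)
    qed
    ultimately show ?thesis
      by simp
  qed
  moreover have "finite S"
    by (simp add: S_def)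
  ultimately show ?thesis
    by blast
qed

text \<open>The cone is defined by strict inequalities at the other lattice points, but the power function
  dominates \<open>F\<close> on the lattice. So adding a sufficiently large multiple of the power function to \<open>F\<close> gives a
  member of the cone, and \<open>F\<close> is a linear combination of two members.\<close>

lemma perfection_cone_span:
  fixes L :: "'a::euclidean_space set"
  assumes v: "lattice_basis n v L" and D: "delaunay_polytope L c D"
    and F: "is_quadratic F" and F0: "\<And>z. z \<in> vertices D \<Longrightarrow> F z = 0"
  shows "(\<lambda>x. F (\<Sum>i<n. x i *\<^sub>R v i)) \<in> fun_vs.span (perfection_cone n v D)"
proof -
  obtain r where r: "\<And>z. z \<in> L \<Longrightarrow> (dist c z)\<^sup>2 \<ge> r\<^sup>2"
    and rD: "\<And>z. z \<in> L \<Longrightarrow> (dist c z)\<^sup>2 = r\<^sup>2 \<longleftrightarrow> z \<in> vertices D"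
    using delaunay_power_function[OF D] by blast
  obtain K where K: "K > 0" "\<And>z. z \<in> L \<Longrightarrow> \<bar>F z\<bar> \<le> K * ((dist c z)\<^sup>2 - r\<^sup>2)"
    using is_quadratic_dominated[OF v F r F0[OF rD[THEN iffD1]]] by blast
  \<comment> \<open>Both \<open>P 0\<close> and \<open>P 1\<close> lie in the cone, and \<open>F\<close> is a combination of them.\<close>
  define P where "P = (\<lambda>t z. (K + t) * ((dist c z)\<^sup>2 - r\<^sup>2) + t * F z)"
  obtain \<alpha> l B where l: "linear l" and B: "bilinear B" and FF: "\<And>z. F z = \<alpha> + l z + B z z"
    using F by (auto simp: is_quadratic_def)
  have inL: "(\<Sum>i<n. of_int (x i) *\<^sub>R v i) \<in> L" for x :: "nat \<Rightarrow> int"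
    using lattice_basis_mem[OF v] by blast
  have cone: "(\<lambda>x. P t (\<Sum>i<n. x i *\<^sub>R v i)) \<in> perfection_cone n v D" if t: "t = 0 \<or> t = 1" for t
  proof -
    have pos: "P t z \<ge> 0" "P t z = 0 \<longleftrightarrow> z \<in> vertices D" if "z \<in> L" for z
    proof -
      have "\<bar>t * F z\<bar> \<le> K * ((dist c z)\<^sup>2 - r\<^sup>2)"
        using K(1) r[OF that] K(2)[OF that] t by (auto simp: abs_mult)
      then have "P t z \<ge> 0" and *: "P t z \<ge> t * ((dist c z)\<^sup>2 - r\<^sup>2)"
        unfolding P_def using r[OF that] t by (auto simp: algebra_simps)
      then show "P t z \<ge> 0" by simp
      show "P t z = 0 \<longleftrightarrow> z \<in> vertices D"
      proof
        assume "P t z = 0"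
        then have "(dist c z)\<^sup>2 - r\<^sup>2 = 0"
          using t * K(1) r[OF that] by (auto simp: P_def)
        then show "z \<in> vertices D"
          using rD[OF that] by simp
      next
        assume z: "z \<in> vertices D"
        then show "P t z = 0"
          using rD[OF that] F0[OF z] by (simp add: P_def)
      qed
    qed
    have "is_quadratic (P t)"
      unfolding is_quadratic_def
    proof (intro exI conjI allI)
      show "linear (\<lambda>z. t * l z - 2 * (K + t) * (c \<bullet> z))"
        by (intro linearI) (simp_all add: linear_add[OF l] linear_cmul[OF l] inner_add_right algebra_simps)
      show "bilinear (\<lambda>z y. t * B z y + (K + t) * (z \<bullet> y))"
        unfolding bilinear_def
        by (intro conjI allI linearI)
          (simp_all add: bilinear_ladd[OF B] bilinear_radd[OF B] bilinear_lmul[OF B] bilinear_rmul[OF B]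
            inner_add_right inner_add_left algebra_simps)
      show "P t z = ((K + t) * (c \<bullet> c - r\<^sup>2) + t * \<alpha>) + (t * l z - 2 * (K + t) * (c \<bullet> z)) + (t * B z z + (K + t) * (z \<bullet> z))" for z
        unfolding P_def FF dist_norm power2_norm_eq_inner
        by (simp add: inner_diff_left inner_diff_right inner_commute algebra_simps)
    qed
    then have "quadratic_function n (\<lambda>x. P t (\<Sum>i<n. x i *\<^sub>R v i))"
      by (rule quadratic_function_combination)
    then show ?thesis
      unfolding perfection_cone_def using pos[OF inL] by simp
  qed
  have comb: "F z = P 1 z - (K + 1) / K * P 0 z" for z
    using K(1) by (simp add: P_def field_simps)
  have "(\<lambda>x. F (\<Sum>i<n. x i *\<^sub>R v i)) =
      (\<lambda>x. P 1 (\<Sum>i<n. x i *\<^sub>R v i)) - (\<lambda>x. (K + 1) / K * P 0 (\<Sum>i<n. x i *\<^sub>R v i))"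
    by (auto simp: fun_eq_iff comb)
  also have "\<dots> \<in> fun_vs.span (perfection_cone n v D)"
    by (intro fun_vs.span_diff fun_vs.span_scale[of "\<lambda>x. P 0 (\<Sum>i<n. x i *\<^sub>R v i)"] fun_vs.span_base cone) auto
  finally show ?thesis .
qed

text \<open>A basis of the cone of \<open>D'\<close> is sent, by restriction from the span of \<open>M\<close> to that of \<open>L\<close>, to linearly
  independent functions that lie in the span of the cone of \<open>D\<close>.\<close>

lemma perfrank_le_of_restriction_injective:
  fixes L M :: "'a::euclidean_space set"
  assumes v: "lattice_basis n v L" and D: "delaunay_polytope L c D"
    and w: "lattice_basis m w M" and D': "delaunay_polytope M c' D'"
    and LM: "L \<subseteq> M" and DD': "vertices D \<subseteq> vertices D'"
    and inj: "\<And>F z. is_quadratic F \<Longrightarrow> (\<And>z. z \<in> vertices D' \<Longrightarrow> F z = 0) \<Longrightarrow>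
                (\<And>z. z \<in> span L \<Longrightarrow> F z = 0) \<Longrightarrow> z \<in> span M \<Longrightarrow> F z = 0"
  shows "perfrank m w D' \<le> perfrank n v D"
proof -
  obtain \<kappa> :: "nat \<Rightarrow> 'a \<Rightarrow> real" where lin: "\<And>i. linear (\<kappa> i)"
    and coord: "\<And>(x :: nat \<Rightarrow> real) i. i < m \<Longrightarrow> \<kappa> i (\<Sum>j<m. x j *\<^sub>R w j) = x i"
    by (rule lattice_basis_coordinates[OF w]) (rule that)
  define ext :: "((nat \<Rightarrow> real) \<Rightarrow> real) \<Rightarrow> 'a \<Rightarrow> real" where "ext = (\<lambda>f z. f (\<lambda>i. \<kappa> i z))"
  define \<phi> :: "((nat \<Rightarrow> real) \<Rightarrow> real) \<Rightarrow> (nat \<Rightarrow> real) \<Rightarrow> real"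
    where "\<phi> = (\<lambda>f x. ext f (\<Sum>i<n. x i *\<^sub>R v i))"
  define V where "V = {f. quadratic_function m f \<and> (\<forall>z\<in>vertices D'. ext f z = 0)}"
  have ext_eq: "ext f (\<Sum>j<m. x j *\<^sub>R w j) = f x" if "quadratic_function m f" for f x
    using that coord by (auto simp: quadratic_function_def ext_def)
  have coneV: "perfection_cone m w D' \<subseteq> V"
  proof
    fix f assume f: "f \<in> perfection_cone m w D'"
    then have q: "quadratic_function m f"
      by (simp add: perfection_cone_def)
    have "ext f z = 0" if "z \<in> vertices D'" for z
    proof -
      have "z \<in> M"
        using D' that by (auto simp: delaunay_polytope_def)
      then obtain x :: "nat \<Rightarrow> int" where "z = (\<Sum>i<m. of_int (x i) *\<^sub>R w i)"
        using lattice_basis_mem[OF w] by blast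
      then show ?thesis
        using f that ext_eq[OF q, of "\<lambda>i. of_int (x i)"] by (simp add: perfection_cone_def)
    qed
    with q show "f \<in> V"
      by (simp add: V_def)
  qed
  have \<phi>V: "\<phi> f \<in> fun_vs.span (perfection_cone n v D)" if "f \<in> V" for f
    unfolding \<phi>_def
    by (rule perfection_cone_span[OF v D])
      (use that DD' is_quadratic_compose_linear[OF _ lin] in \<open>auto simp: V_def ext_def\<close>)
  have kernel: "f = 0" if "f \<in> V" "\<phi> f = 0" for f
  proof
    fix x
    have q: "is_quadratic (ext f)" "quadratic_function m f"
      using that is_quadratic_compose_linear[OF _ lin] by (auto simp: V_def ext_def)
    have "ext f (\<Sum>j<m. x j *\<^sub>R w j) = 0"
    proof (rule inj[OF q(1)])
      fix z assume "z \<in> span L"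
      then obtain y where "z = (\<Sum>i<n. y i *\<^sub>R v i)"
        using lattice_basis_coordinates[OF v] by metis
      then show "ext f z = 0"
        using fun_cong[OF that(2), of y] by (simp add: \<phi>_def)
    next
      show "(\<Sum>j<m. x j *\<^sub>R w j) \<in> span M"
        using lattice_basis_vector[OF w] by (intro span_sum span_scale span_base) auto
    qed (use that in \<open>auto simp: V_def\<close>)
    then show "f x = 0 x"
      by (simp add: ext_eq[OF q(2)])
  qed
  have subV: "fun_vs.subspace V"
    unfolding fun_vs.subspace_def
  proof (intro conjI ballI allI)
    show "0 \<in> V"
      by (auto simp: V_def ext_def quadratic_function_def intro!: exI[of _ 0])
    fix f assume "f \<in> V"
    then obtain a b q where f: "\<And>x. f x = a + (\<Sum>i<m. b i * x i) + (\<Sum>i<m. \<Sum>j<m. q i j * x i * x j)"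
      and f0: "\<And>z. z \<in> vertices D' \<Longrightarrow> ext f z = 0"
      unfolding V_def quadratic_function_def by blast
    have "quadratic_function m (\<lambda>x. k * f x)" for k
      unfolding quadratic_function_def
      by (intro exI[of _ "k * a"] exI[of _ "\<lambda>i. k * b i"] exI[of _ "\<lambda>i j. k * q i j"])
        (simp add: f algebra_simps sum_distrib_left)
    then show "(\<lambda>x. k * f x) \<in> V" for k
      using f0 by (simp add: V_def ext_def)
    fix g assume "g \<in> V"
    then obtain a' b' q' where g: "\<And>x. g x = a' + (\<Sum>i<m. b' i * x i) + (\<Sum>i<m. \<Sum>j<m. q' i j * x i * x j)"
      and g0: "\<And>z. z \<in> vertices D' \<Longrightarrow> ext g z = 0"
      unfolding V_def quadratic_function_def by blast
    have "quadratic_function m (f + g)"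
      unfolding quadratic_function_def
      by (intro exI[of _ "a + a'"] exI[of _ "\<lambda>i. b i + b' i"] exI[of _ "\<lambda>i j. q i j + q' i j"])
        (simp add: f g algebra_simps sum.distrib)
    then show "f + g \<in> V"
      using f0 g0 by (auto simp: V_def ext_def)
  qed
  interpret fs: vector_space_pair "\<lambda>(a::real) (f :: (nat \<Rightarrow> real) \<Rightarrow> real) x. a * f x"
    "\<lambda>(a::real) (f :: (nat \<Rightarrow> real) \<Rightarrow> real) x. a * f x"
    by unfold_locales
  have lin\<phi>: "Vector_Spaces.linear (\<lambda>(a::real) f x. a * f x) (\<lambda>(a::real) f x. a * f x) \<phi>"
    by unfold_locales (auto simp: \<phi>_def ext_def fun_eq_iff)
  obtain B where B: "B \<subseteq> perfection_cone m w D'" "fun_vs.independent B"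
    "perfection_cone m w D' \<subseteq> fun_vs.span B" "card B = fun_vs.dim (perfection_cone m w D')"
    by (rule fun_vs.basis_exists)
  obtain C where C: "C \<subseteq> perfection_cone n v D" "fun_vs.independent C"
    "perfection_cone n v D \<subseteq> fun_vs.span C" "card C = fun_vs.dim (perfection_cone n v D)"
    by (rule fun_vs.basis_exists)
  have BV: "fun_vs.span B \<subseteq> V"
    using B(1) coneV by (intro fun_vs.span_minimal subV) auto
  have inj\<phi>: "inj_on \<phi> (fun_vs.span B)"
    using BV kernel by (subst fs.linear_inj_on_iff_eq_0[OF lin\<phi> fun_vs.subspace_span]) auto
  have ind: "fun_vs.independent (\<phi> ` B)"
    by (rule fs.linear_independent_injective_image[OF lin\<phi> B(2) inj\<phi>])
  have "finite C"
  proof -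
    obtain S where "finite S" "{f. quadratic_function n f} \<subseteq> fun_vs.span S"
      using quadratic_functions_finitely_generated by blast
    moreover have "C \<subseteq> {f. quadratic_function n f}"
      using C(1) by (auto simp: perfection_cone_def)
    ultimately show ?thesis
      using fun_vs.independent_span_bound[OF _ C(2)] by blast
  qed
  moreover have "\<phi> ` B \<subseteq> fun_vs.span C"
  proof
    fix y assume "y \<in> \<phi> ` B"
    then have "y \<in> fun_vs.span (perfection_cone n v D)"
      using \<phi>V B(1) coneV by blast
    also have "\<dots> \<subseteq> fun_vs.span C"
      using C(3) by (intro fun_vs.span_minimal fun_vs.subspace_span)
    finally show "y \<in> fun_vs.span C" .
  qed
  ultimately have "card (\<phi> ` B) \<le> card C"
    using fun_vs.independent_span_bound[OF _ ind] by blast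
  moreover have "card (\<phi> ` B) = card B"
    by (rule card_image) (meson fun_vs.span_superset inj\<phi> inj_on_subset)
  ultimately show ?thesis
    using B(4) C(4) by (simp add: perfrank_def)
qed

section \<open>Stacking translates of a lattice\<close>

lemma delaunay_affine_hull:
  fixes L :: "'a::euclidean_space set"
  assumes v: "lattice_basis n v L" and D: "delaunay_polytope L c D" and "aff_dim D = int n"
  shows "affine hull (vertices D) = span L" and "affine hull D = span L"
proof -
  have poly: "polytope D" and vL: "vertices D \<subseteq> L"
    using D by (auto simp: delaunay_polytope_def)
  have hull: "affine hull (vertices D) = affine hull D"
    by (metis affine_hull_convex_hull polytope_convex_hull_vertices[OF poly])
  have "aff_dim (affine hull (vertices D)) = aff_dim (span L)"
    using assms(3) lattice_basis_dim[OF v] by (simp add: hull aff_dim_subspace)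
  moreover have "affine hull (vertices D) \<subseteq> span L"
    using vL by (intro hull_minimal) (auto simp: span_base subspace_imp_affine)
  moreover have "D \<noteq> {}"
    using assms(3) by auto
  ultimately show "affine hull (vertices D) = span L"
    by (intro affine_dim_equal) (auto simp: subspace_imp_affine hull)
  then show "affine hull D = span L"
    using hull by simp
qed

lemma layered_mem: "x \<in> L \<Longrightarrow> x + of_int k *\<^sub>R e \<in> layered L e"
  unfolding layered_def by blast

lemma layered_superset: "L \<subseteq> layered L e"
  using layered_mem[of _ L 0 e] by auto

lemma layered_step: "lattice_basis n v L \<Longrightarrow> e \<in> layered L e"
  using layered_mem[of 0 L 1 e] lattice_basis_zero by auto

lemma layered_add:
  assumes "lattice_basis n v L" "y \<in> layered L e" "z \<in> layered L e"
  shows "y + z \<in> layered L e"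
proof -
  obtain x k x' k' where "y = x + of_int k *\<^sub>R e" "x \<in> L" "z = x' + of_int k' *\<^sub>R e" "x' \<in> L"
    using assms(2,3) unfolding layered_def by blast
  then have "y + z = (x + x') + of_int (k + k') *\<^sub>R e" "x + x' \<in> L"
    using lattice_basis_add[OF assms(1)] by (auto simp: algebra_simps)
  then show ?thesis
    using layered_mem by metis
qed

lemma layered_uminus:
  assumes "lattice_basis n v L" "y \<in> layered L e"
  shows "- y \<in> layered L e"
proof -
  obtain x k where "y = x + of_int k *\<^sub>R e" "x \<in> L"
    using assms(2) unfolding layered_def by blast
  then have "- y = - x + of_int (- k) *\<^sub>R e" "- x \<in> L"
    using lattice_basis_uminus[OF assms(1)] by auto
  then show ?thesis
    using layered_mem by metis
qed

lemma layered_diff: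
  assumes "lattice_basis n v L" "y \<in> layered L e" "z \<in> layered L e"
  shows "y - z \<in> layered L e"
  using layered_add[OF assms(1,2) layered_uminus[OF assms(1,3)]] by simp

text \<open>Pythagoras: the vector from \<open>x + ke\<close> to \<open>e/2\<close> is the sum of \<open>(1 - 2k)c - x\<close>, which lies in \<open>span L\<close>, and a
  multiple of \<open>2c - e\<close>, which is orthogonal to it.\<close>

lemma layered_distance:
  fixes L :: "'a::euclidean_space set"
  assumes c: "c \<in> span L" and x: "x \<in> span L"
    and orth: "\<forall>z\<in>span L. orthogonal (2 *\<^sub>R c - e) z"
  shows "(dist ((1/2) *\<^sub>R e) (x + of_int k *\<^sub>R e))\<^sup>2
      = (dist ((1 - 2 * of_int k) *\<^sub>R c) x)\<^sup>2 + (1/2 - of_int k)\<^sup>2 * (norm (2 *\<^sub>R c - e))\<^sup>2"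
proof -
  define y where "y = (1 - 2 * of_int k) *\<^sub>R c - x"
  define h where "h = (of_int k - 1/2) *\<^sub>R (2 *\<^sub>R c - e)"
  have "y \<in> span L"
    unfolding y_def using c x by (intro span_diff span_scale)
  then have o: "orthogonal y h"
    using orth by (simp add: h_def orthogonal_clauses orthogonal_commute)
  have "(1/2) *\<^sub>R e - (x + of_int k *\<^sub>R e) = y + h"
    by (simp add: y_def h_def algebra_simps)
  then have "(dist ((1/2) *\<^sub>R e) (x + of_int k *\<^sub>R e))\<^sup>2 = (norm y)\<^sup>2 + (norm h)\<^sup>2"
    using norm_add_Pythagorean[OF o] by (simp add: dist_norm)
  also have "(norm h)\<^sup>2 = (1/2 - of_int k)\<^sup>2 * (norm (2 *\<^sub>R c - e))\<^sup>2"
    by (simp add: h_def power_mult_distrib power2_commute)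
  finally show ?thesis
    by (simp add: y_def dist_norm)
qed

lemma delaunay_infdist:
  fixes L :: "'a::euclidean_space set"
  assumes v: "lattice_basis n v L" and D: "delaunay_polytope L c D" and "vertices D \<noteq> {}"
  shows "vertices D = sphere c (infdist c L) \<inter> L"
proof -
  obtain \<rho> where \<rho>: "ball c \<rho> \<inter> L = {}" "vertices D = sphere c \<rho> \<inter> L"
    using D by (auto simp: delaunay_polytope_def)
  obtain u where "u \<in> sphere c \<rho> \<inter> L"
    using assms(3) \<rho>(2) by blast
  then have u: "u \<in> L" "dist c u = \<rho>"
    by auto
  have "L \<noteq> {}"
    using lattice_basis_zero[OF v] by auto
  then have "infdist c L \<ge> \<rho>"
    using delaunay_radius_eq_infdist(2)[OF v, of c] \<rho>(1) by (force simp: not_less[symmetric])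
  moreover have "infdist c L \<le> \<rho>"
    using infdist_le[OF u(1), of c] u(2) by simp
  ultimately show ?thesis
    using \<rho>(2) by simp
qed

text \<open>The identity \<open>(1/2 - k)\<^sup>2 = k(k - 1) + 1/4\<close> turns the distance formula into the assumption on \<open>k\<close>.\<close>

lemma layered_distance_ge:
  fixes L :: "'a::euclidean_space set"
  assumes c: "c \<in> span L"
    and orth: "\<forall>z\<in>span L. orthogonal (2 *\<^sub>R c - e) z"
    and far: "\<And>k. (infdist c L)\<^sup>2 \<le> (infdist ((1 - 2 * of_int k) *\<^sub>R c) L)\<^sup>2
                + of_int (k * (k - 1)) * (norm (2 *\<^sub>R c - e))\<^sup>2"
    and z: "z \<in> layered L e"
  shows "(infdist c L)\<^sup>2 + (norm (2 *\<^sub>R c - e))\<^sup>2 / 4 \<le> (dist ((1/2) *\<^sub>R e) z)\<^sup>2"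
proof -
  define \<delta> where "\<delta> = (norm (2 *\<^sub>R c - e))\<^sup>2"
  obtain x k where xk: "z = x + of_int k *\<^sub>R e" "x \<in> L"
    using z unfolding layered_def by blast
  have "(infdist ((1 - 2 * of_int k) *\<^sub>R c) L)\<^sup>2 \<le> (dist ((1 - 2 * of_int k) *\<^sub>R c) x)\<^sup>2"
    using infdist_le[OF xk(2)] by (intro power_mono infdist_nonneg) auto
  then have "(infdist c L)\<^sup>2 + \<delta> / 4
      \<le> (dist ((1 - 2 * of_int k) *\<^sub>R c) x)\<^sup>2 + of_int (k * (k - 1)) * \<delta> + \<delta> / 4"
    using far[of k] by (simp add: \<delta>_def)
  also have "\<dots> = (dist ((1/2) *\<^sub>R e) z)\<^sup>2"
    unfolding xk(1) layered_distance[OF c span_base[OF xk(2)] orth] \<delta>_def[symmetric]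
    by (simp add: power2_eq_square field_simps)
  finally show ?thesis
    by (simp add: \<delta>_def)
qed

text \<open>Under the stated inequality the layers 0 and 1 are nearest to \<open>e/2\<close>, so the empty sphere of \<open>D\<close> extends to
  an empty sphere about \<open>e/2\<close>. It meets the layer 0 in the vertices of \<open>D\<close>, and \<open>x \<mapsto> e - x\<close> maps the
  whole lattice and the sphere to themselves.\<close>

lemma layered_delaunay:
  fixes L :: "'a::euclidean_space set"
  assumes v: "lattice_basis n v L" and D: "delaunay_polytope L c D" and ne: "vertices D \<noteq> {}"
    and orth: "\<forall>z\<in>span L. orthogonal (2 *\<^sub>R c - e) z"
    and w: "lattice_basis m w (layered L e)"
    and far: "\<And>k. (infdist c L)\<^sup>2 \<le> (infdist ((1 - 2 * of_int k) *\<^sub>R c) L)\<^sup>2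
                + of_int (k * (k - 1)) * (norm (2 *\<^sub>R c - e))\<^sup>2"
  defines "c' \<equiv> (1/2) *\<^sub>R e"
  defines "D' \<equiv> delaunay_at (layered L e) c'"
  shows "delaunay_polytope (layered L e) c' D'"
    and "vertices D' = {z \<in> layered L e. (dist c' z)\<^sup>2 = (infdist c L)\<^sup>2 + (norm (2 *\<^sub>R c - e))\<^sup>2 / 4}"
    and "vertices D \<subseteq> vertices D'"
    and "\<And>z. z \<in> vertices D' \<Longrightarrow> e - z \<in> vertices D'"
    and "centrally_symmetric c' D'"
    and "D \<union> (\<lambda>x. 2 *\<^sub>R c' - x) ` D \<subseteq> D'"
proof -
  define M where "M = layered L e"
  define \<delta> where "\<delta> = (norm (2 *\<^sub>R c - e))\<^sup>2"
  define \<rho> where "\<rho> = sqrt ((infdist c L)\<^sup>2 + \<delta> / 4)"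
  have \<rho>2: "\<rho>\<^sup>2 = (infdist c L)\<^sup>2 + \<delta> / 4" and \<rho>0: "\<rho> \<ge> 0"
    by (auto simp: \<rho>_def \<delta>_def)
  have c: "c \<in> span L"
    using D by (simp add: delaunay_polytope_def)
  have vD: "vertices D = sphere c (infdist c L) \<inter> L"
    by (rule delaunay_infdist[OF v D ne])
  have dist: "(dist c' (x + of_int k *\<^sub>R e))\<^sup>2 = (dist ((1 - 2 * of_int k) *\<^sub>R c) x)\<^sup>2 + (1/2 - of_int k)\<^sup>2 * \<delta>"
    if "x \<in> L" for x k
    unfolding c'_def \<delta>_def by (rule layered_distance[OF c span_base[OF that] orth])
  have "\<rho> \<le> dist c' z" if z: "z \<in> M" for z
  proof (rule power2_le_imp_le)
    show "\<rho>\<^sup>2 \<le> (dist c' z)\<^sup>2"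
      unfolding \<rho>2 \<delta>_def c'_def by (rule layered_distance_ge[OF c orth far z[unfolded M_def]])
  qed simp
  then have ball: "ball c' \<rho> \<inter> M = {}"
    by force
  have DS: "vertices D \<subseteq> sphere c' \<rho> \<inter> M"
  proof
    fix u assume u: "u \<in> vertices D"
    then have "(dist c' u)\<^sup>2 = \<rho>\<^sup>2"
      unfolding \<rho>2 using dist[of u 0] vD by (simp add: power2_eq_square)
    then have "dist c' u = \<rho>"
      using \<rho>0 by (simp add: power2_eq_iff_nonneg)
    then show "u \<in> sphere c' \<rho> \<inter> M"
      using u vD layered_superset[of L e] by (auto simp: M_def)
  qed
  then have sphere: "sphere c' \<rho> \<inter> M \<noteq> {}"
    using ne by auto
  have c'M: "c' \<in> span M"
    unfolding c'_def M_def by (intro span_scale span_base layered_step[OF v])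
  note at = delaunay_polytope_at[OF w[folded M_def] c'M ball sphere]
  show "delaunay_polytope (layered L e) c' D'"
    using at(1) by (simp add: D'_def M_def)
  have vD': "vertices D' = sphere c' \<rho> \<inter> M"
    using at(2) by (simp add: D'_def M_def)
  show "vertices D' = {z \<in> layered L e. (dist c' z)\<^sup>2 = (infdist c L)\<^sup>2 + (norm (2 *\<^sub>R c - e))\<^sup>2 / 4}"
    unfolding vD' \<delta>_def[symmetric] \<rho>2[symmetric] using \<rho>0 by (auto simp: M_def power2_eq_iff_nonneg)
  show vDD': "vertices D \<subseteq> vertices D'"
    using DS vD' by simp
  show refl: "e - z \<in> vertices D'" if "z \<in> vertices D'" for z
  proof -
    have "e = c' + c'"
      by (simp add: c'_def flip: scaleR_add_left)
    then have "dist c' (e - z) = dist c' z"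
      by (simp add: dist_norm norm_minus_commute)
    then show ?thesis
      using that layered_diff[OF v layered_step[OF v]] by (auto simp: vD' M_def)
  qed
  have two: "2 *\<^sub>R c' = e"
    by (simp add: c'_def)
  show "centrally_symmetric c' D'"
    unfolding centrally_symmetric_def two
  proof (intro equalityI subsetI)
    fix z assume "z \<in> vertices D'"
    then show "z \<in> (\<lambda>x. e - x) ` vertices D'"
      using refl[of z] by (auto intro!: image_eqI[of _ _ "e - z"])
  qed (use refl in auto)
  have D_hull: "D = convex hull (vertices D)"
    using D by (intro polytope_convex_hull_vertices) (simp add: delaunay_polytope_def)
  have D'_hull: "D' = convex hull (vertices D')"
    unfolding vD' using delaunay_at_eq[OF ball sphere] by (simp add: D'_def M_def)
  have "(\<lambda>x. e - x) ` D = convex hull ((\<lambda>x. e - x) ` vertices D)"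
    using convex_hull_affinity[of e "-1" "vertices D"] D_hull by simp
  also have "\<dots> \<subseteq> D'"
    by (subst D'_hull) (use refl vDD' in \<open>auto intro!: hull_mono\<close>)
  finally have "(\<lambda>x. e - x) ` D \<subseteq> D'" .
  moreover have "D \<subseteq> D'"
    by (subst D'_hull, subst D_hull) (intro hull_mono vDD')
  ultimately show "D \<union> (\<lambda>x. 2 *\<^sub>R c' - x) ` D \<subseteq> D'"
    by (simp add: two)
qed

text \<open>As \<open>F\<close> vanishes on \<open>span L\<close>, one has \<open>F (u + t e) = t (h u) + t\<^sup>2 a\<close> with \<open>h\<close> affine.
  Vanishing on the reflected points in the layer 1 means \<open>h = - a\<close> on an affinely spanning set, hence
  everywhere, so \<open>F (u + t e) = (t\<^sup>2 - t) a\<close>. A zero with \<open>t\<close> different from 0 and 1 forces \<open>a = 0\<close>.\<close>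

lemma is_quadratic_vanishes_of_three_layers:
  fixes L :: "'a::euclidean_space set"
  assumes F: "is_quadratic F" and F0: "\<And>z. z \<in> span L \<Longrightarrow> F z = 0"
    and P: "affine hull P = span L" and F1: "\<And>u. u \<in> P \<Longrightarrow> F (e - u) = 0"
    and x: "x \<in> span L" and k: "k \<noteq> 0" "k \<noteq> 1" and Fk: "F (x + of_int k *\<^sub>R e) = 0"
    and z: "z \<in> span (layered L e)"
  shows "F z = 0"
proof -
  obtain \<alpha> l B where l: "linear l" and B: "bilinear B" and FF: "\<And>z. F z = \<alpha> + l z + B z z"
    using F by (auto simp: is_quadratic_def)
  define g where "g = (\<lambda>u. B u e + B e u)"
  define a where "a = B e e"
  have g: "linear g"
    unfolding g_def
    by (intro linearI)
      (simp_all add: bilinear_ladd[OF B] bilinear_radd[OF B] bilinear_lmul[OF B] bilinear_rmul[OF B] algebra_simps)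
  have expand: "F (u + t *\<^sub>R e) = t * (l e + g u) + t\<^sup>2 * a" if "u \<in> span L" for u t
    using F0[OF that] unfolding FF g_def a_def
    by (simp add: linear_add[OF l] linear_cmul[OF l] bilinear_ladd[OF B] bilinear_radd[OF B]
        bilinear_lmul[OF B] bilinear_rmul[OF B] power2_eq_square algebra_simps)
  have "span L \<subseteq> {u. g u = l e + a}"
    unfolding P[symmetric]
  proof (rule hull_minimal)
    show "P \<subseteq> {u. g u = l e + a}"
    proof
      fix u assume u: "u \<in> P"
      then have "- u \<in> span L"
        using P hull_inc[of u P affine] by (simp add: span_neg)
      from expand[OF this, of 1] F1[OF u] show "u \<in> {u. g u = l e + a}"
        by (simp add: linear_neg[OF g])
    qed
    show "affine {u. g u = l e + a}"
      unfolding affine_def by (auto simp: linear_add[OF g] linear_cmul[OF g] simp flip: distrib_right)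
  qed
  then have layer: "F (u + t *\<^sub>R e) = (t\<^sup>2 - t) * a" if "u \<in> span L" for u t
  proof -
    have "g (- u) = l e + a"
      using \<open>span L \<subseteq> _\<close> span_neg[OF that] by blast
    then have "l e + g u = - a"
      by (simp add: linear_neg[OF g])
    then show ?thesis
      unfolding expand[OF that] by (simp add: algebra_simps)
  qed
  have "real_of_int (k * (k - 1)) \<noteq> 0"
    using k by simp
  then have "a = 0"
    using Fk layer[OF x, of "of_int k"] by (auto simp: power2_eq_square algebra_simps)
  have "layered L e \<subseteq> span (insert e L)"
    unfolding layered_def by (auto intro!: span_add span_scale intro: span_base)
  then have "z \<in> span (insert e L)"
    using z span_mono[of "layered L e" "span (insert e L)"] by (auto simp: span_span)
  then obtain t where "z - t *\<^sub>R e \<in> span L"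
    by (auto simp: span_breakdown_eq)
  from layer[OF this, of t] \<open>a = 0\<close> show ?thesis
    by simp
qed

lemma layered_lattice_basis:
  fixes L :: "'a::euclidean_space set"
  assumes v: "lattice_basis n v L" and e: "e \<notin> span L"
  shows "lattice_basis (n + 1) (v(n := e)) (layered L e)"
proof -
  have im: "v(n := e) ` {..<n + 1} = insert e (v ` {..<n})"
    by (auto simp: less_Suc_eq fun_upd_def)
  have e': "e \<notin> span (v ` {..<n})"
    using e lattice_basis_span[OF v] by simp
  have "inj_on (v(n := e)) {..<n + 1}"
    using v e' span_base[of e "v ` {..<n}"] unfolding lattice_basis_def
    by (auto simp: inj_on_def less_Suc_eq)
  moreover have "independent (v(n := e) ` {..<n + 1})"
    unfolding im using independent_insertI[OF e'] v by (simp add: lattice_basis_def)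
  moreover have "layered L e = {\<Sum>i<n + 1. of_int (x i) *\<^sub>R (v(n := e)) i | x :: nat \<Rightarrow> int. True}"
  proof (intro equalityI subsetI)
    fix y assume "y \<in> layered L e"
    then obtain x k where "y = x + of_int k *\<^sub>R e" "x \<in> L"
      unfolding layered_def by blast
    moreover from this obtain a :: "nat \<Rightarrow> int" where "x = (\<Sum>i<n. of_int (a i) *\<^sub>R v i)"
      using lattice_basis_mem[OF v] by blast
    ultimately have "y = (\<Sum>i<n + 1. of_int ((a(n := k)) i) *\<^sub>R (v(n := e)) i)"
      by simp
    then show "y \<in> {\<Sum>i<n + 1. of_int (x i) *\<^sub>R (v(n := e)) i | x :: nat \<Rightarrow> int. True}"
      by (intro CollectI exI[of _ "a(n := k)"]) simp
  next
    fix y assume "y \<in> {\<Sum>i<n + 1. of_int (x i) *\<^sub>R (v(n := e)) i | x :: nat \<Rightarrow> int. True}"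
    then obtain x :: "nat \<Rightarrow> int" where "y = (\<Sum>i<n + 1. of_int (x i) *\<^sub>R (v(n := e)) i)"
      by blast
    then have "y = (\<Sum>i<n. of_int (x i) *\<^sub>R v i) + of_int (x n) *\<^sub>R e"
      by simp
    then show "y \<in> layered L e"
      using lattice_basis_mem[OF v] layered_mem by metis
  qed
  ultimately show ?thesis
    unfolding lattice_basis_def by blast
qed

section \<open>The superlattice in the same span\<close>

text \<open>The basis is triangular, as in the Hermite normal form. Let \<open>Mk k\<close> be the part of \<open>M\<close> in the span of the
  first \<open>k\<close> basis vectors of \<open>L\<close>. The last coordinate takes values in \<open>(1/m) \<int>\<close> on \<open>Mk (k + 1)\<close>, so it has a
  smallest positive value there; an element with this value generates \<open>Mk (k + 1)\<close> modulo \<open>Mk k\<close>.\<close>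

lemma superlattice_basis_exists:
  fixes L M :: "'a::euclidean_space set"
  assumes v: "lattice_basis n v L"
    and add: "\<And>y z. y \<in> M \<Longrightarrow> z \<in> M \<Longrightarrow> y + z \<in> M" and neg: "\<And>z. z \<in> M \<Longrightarrow> - z \<in> M"
    and LM: "L \<subseteq> M" and m: "m > 0" and mM: "\<And>z. z \<in> M \<Longrightarrow> of_int m *\<^sub>R z \<in> L"
  shows "is_lattice n M"
proof -
  obtain \<kappa> :: "nat \<Rightarrow> 'a \<Rightarrow> real" where lin: "\<And>i. linear (\<kappa> i)"
    and coord: "\<And>(x :: nat \<Rightarrow> real) i. i < n \<Longrightarrow> \<kappa> i (\<Sum>j<n. x j *\<^sub>R v j) = x i"
    and expand: "\<And>z. z \<in> span L \<Longrightarrow> (\<Sum>i<n. \<kappa> i z *\<^sub>R v i) = z"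
    by (rule lattice_basis_coordinates[OF v]) (rule that)
  note lins = linear_add[OF lin] linear_cmul[OF lin] linear_diff[OF lin] linear_neg[OF lin] linear_0[OF lin]
  have MsL: "M \<subseteq> span L"
  proof
    fix z assume "z \<in> M"
    then have "(1 / of_int m) *\<^sub>R (of_int m *\<^sub>R z) \<in> span L"
      using mM by (intro span_scale span_base)
    then show "z \<in> span L"
      using m by simp
  qed
  have zero: "0 \<in> M"
    using LM lattice_basis_zero[OF v] by blast
  have diff: "y - z \<in> M" if "y \<in> M" "z \<in> M" for y z
    using add[OF that(1) neg[OF that(2)]] by simp
  have nat_mult: "of_nat k *\<^sub>R z \<in> M" if "z \<in> M" for k z
    by (induction k) (use that add zero in \<open>auto simp: algebra_simps\<close>)
  have mult: "of_int k *\<^sub>R z \<in> M" if "z \<in> M" for k z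
    using nat_mult[OF that] neg[OF nat_mult[OF that]] by (cases k rule: int_cases2) auto
  have integral: "\<exists>k. of_int m * \<kappa> i z = of_int k" if z: "z \<in> M" and i: "i < n" for z i
  proof -
    obtain a :: "nat \<Rightarrow> int" where "of_int m *\<^sub>R z = (\<Sum>i<n. of_int (a i) *\<^sub>R v i)"
      using mM[OF z] lattice_basis_mem[OF v] by blast
    then have "\<kappa> i (of_int m *\<^sub>R z) = of_int (a i)"
      using coord[OF i, of "\<lambda>i. of_int (a i)"] by simp
    then show ?thesis
      by (auto simp: lins)
  qed
  define Mk where "Mk = (\<lambda>k. {z \<in> M. \<forall>i<n. k \<le> i \<longrightarrow> \<kappa> i z = 0})"
  have step: "\<exists>w\<in>Mk (Suc k). \<kappa> k w > 0 \<and> (\<forall>z\<in>Mk (Suc k). \<exists>q. z - of_int q *\<^sub>R w \<in> Mk k)"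
    if k: "k < n" for k
  proof -
    define A where "A = {z \<in> Mk (Suc k). \<kappa> k z > 0}"
    have vk: "\<kappa> i (v k) = of_bool (i = k)" if "i < n" for i
    proof -
      have "v k = (\<Sum>j<n. of_bool (j = k) *\<^sub>R v j)"
        using k by (simp add: of_bool_def if_distrib[of "\<lambda>t. t *\<^sub>R _"] cong: if_cong)
      then show ?thesis
        using coord[OF that, of "\<lambda>j. of_bool (j = k)"] by simp
    qed
    then have "v k \<in> A"
      using k LM lattice_basis_vector[OF v k] by (auto simp: A_def Mk_def)
    \<comment> \<open>On \<open>M\<close> the numbers \<open>m * \<kappa> k z\<close> are integers, so a minimum over the naturals gives the least positive coordinate.\<close>
    define w where "w = arg_min_on (\<lambda>z. nat \<lfloor>of_int m * \<kappa> k z\<rfloor>) A"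
    have w: "w \<in> A"
      unfolding w_def arg_min_on_def using \<open>v k \<in> A\<close> by (rule arg_min_natI)
    have min: "\<kappa> k w \<le> \<kappa> k z" if z: "z \<in> A" for z
    proof -
      have le: "nat \<lfloor>of_int m * \<kappa> k w\<rfloor> \<le> nat \<lfloor>of_int m * \<kappa> k z\<rfloor>"
        unfolding w_def arg_min_on_def using z by (rule arg_min_nat_le)
      have "w \<in> M" "z \<in> M"
        using w z by (auto simp: A_def Mk_def)
      then obtain p q where p: "of_int m * \<kappa> k w = of_int p" and q: "of_int m * \<kappa> k z = of_int q"
        using integral[OF _ k] by metis
      have "of_int q > (0::real)"
        using z m by (auto simp: A_def simp flip: q)
      then have "p \<le> q"
        using le unfolding p q by simp
      then have "of_int m * \<kappa> k w \<le> of_int m * \<kappa> k z"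
        unfolding p q by simp
      then show ?thesis
        using m by simp
    qed
    have "\<exists>q. z - of_int q *\<^sub>R w \<in> Mk k" if z: "z \<in> Mk (Suc k)" for z
    proof -
      define q where "q = \<lfloor>\<kappa> k z / \<kappa> k w\<rfloor>"
      define y where "y = z - of_int q *\<^sub>R w"
      have wpos: "\<kappa> k w > 0"
        using w by (simp add: A_def)
      have yM: "y \<in> Mk (Suc k)"
        using z w mult diff by (auto simp: y_def A_def Mk_def lins)
      have "of_int q \<le> \<kappa> k z / \<kappa> k w" "\<kappa> k z / \<kappa> k w < of_int q + 1"
        unfolding q_def by linarith+
      then have "0 \<le> \<kappa> k y" "\<kappa> k y < \<kappa> k w"
        using wpos by (auto simp: y_def lins field_simps)
      then have "\<kappa> k y = 0"
        using min[of y] yM by (force simp: A_def)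
      then have "y \<in> Mk k"
        using yM by (auto simp: Mk_def) (metis le_neq_implies_less not_less_eq_eq Suc_leI)
      then show ?thesis
        unfolding y_def by blast
    qed
    with w show ?thesis
      by (auto simp: A_def)
  qed
  then obtain w where w: "\<And>k. k < n \<Longrightarrow> w k \<in> Mk (Suc k)"
    and red: "\<And>k z. k < n \<Longrightarrow> z \<in> Mk (Suc k) \<Longrightarrow> \<exists>q. z - of_int q *\<^sub>R w k \<in> Mk k"
    by metis
  have comb: "\<exists>a :: nat \<Rightarrow> int. z = (\<Sum>i<k. of_int (a i) *\<^sub>R w i)" if "k \<le> n" "z \<in> Mk k" for k z
    using that
  proof (induction k arbitrary: z)
    case 0
    then have "z = 0"
      using expand[of z] MsL by (auto simp: Mk_def)
    then show ?case
      by simp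
  next
    case (Suc k)
    then obtain q where "z - of_int q *\<^sub>R w k \<in> Mk k"
      using red[of k z] by auto
    with Suc obtain a :: "nat \<Rightarrow> int" where a: "z - of_int q *\<^sub>R w k = (\<Sum>i<k. of_int (a i) *\<^sub>R w i)"
      by (metis Suc_leD)
    have "z = (\<Sum>i<Suc k. of_int ((a(k := q)) i) *\<^sub>R w i)"
      using a by (simp add: algebra_simps)
    then show ?case
      by blast
  qed
  have wM: "w k \<in> M" if "k < n" for k
    using w[OF that] by (simp add: Mk_def)
  have M: "M = {\<Sum>i<n. of_int (a i) *\<^sub>R w i | a :: nat \<Rightarrow> int. True}"
  proof (intro equalityI subsetI)
    fix z assume "z \<in> M"
    then have "z \<in> Mk n"
      by (simp add: Mk_def)
    then show "z \<in> {\<Sum>i<n. of_int (a i) *\<^sub>R w i | a :: nat \<Rightarrow> int. True}"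
      using comb[of n z] by simp
  next
    have sums: "(\<Sum>i\<in>I. of_int (a i) *\<^sub>R w i) \<in> M" if "finite I" "I \<subseteq> {..<n}" for I and a :: "nat \<Rightarrow> int"
      using that by (induction I rule: finite_induct) (auto intro!: zero add mult wM)
    fix z assume "z \<in> {\<Sum>i<n. of_int (a i) *\<^sub>R w i | a :: nat \<Rightarrow> int. True}"
    then show "z \<in> M"
      using sums[of "{..<n}"] by auto
  qed
  have "L \<subseteq> span (w ` {..<n})"
    using LM unfolding M by (auto intro!: span_sum span_scale intro: span_base)
  then have dim: "n \<le> dim (w ` {..<n})"
    using dim_mono[of L "w ` {..<n}"] lattice_basis_dim[OF v] by simp
  have "dim (w ` {..<n}) \<le> card (w ` {..<n})"
    by (intro dim_le_card span_superset) auto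
  moreover have "card (w ` {..<n}) \<le> n"
    using card_image_le[of "{..<n}" w] by simp
  ultimately have card: "card (w ` {..<n}) = n" "dim (w ` {..<n}) = n"
    using dim by auto
  have "inj_on w {..<n}"
    using card(1) by (intro eq_card_imp_inj_on) auto
  moreover have "independent (w ` {..<n})"
    using card by (intro card_le_dim_spanning[of _ "w ` {..<n}"] span_superset) auto
  ultimately show ?thesis
    using M unfolding is_lattice_def lattice_basis_def by blast
qed

text \<open>Modulo \<open>L\<close> every multiple of \<open>a\<close> is congruent to a point of a bounded fundamental cell. A bounded part of a
  uniformly discrete group is finite, so two multiples must be congruent to the same point.\<close>

lemma multiple_in_lattice:
  fixes L :: "'a::euclidean_space set"
  assumes v: "lattice_basis n v L" and a: "a \<in> span L"
    and \<epsilon>: "\<epsilon> > 0" "\<And>w. w \<in> layered L a \<Longrightarrow> w \<noteq> 0 \<Longrightarrow> \<epsilon> \<le> norm w"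
  shows "\<exists>m>0. of_int m *\<^sub>R a \<in> L"
proof -
  obtain \<kappa> :: "nat \<Rightarrow> 'a \<Rightarrow> real" where lin: "\<And>i. linear (\<kappa> i)"
    and coord: "\<And>(x :: nat \<Rightarrow> real) i. i < n \<Longrightarrow> \<kappa> i (\<Sum>j<n. x j *\<^sub>R v j) = x i"
    and expand: "\<And>z. z \<in> span L \<Longrightarrow> (\<Sum>i<n. \<kappa> i z *\<^sub>R v i) = z"
    by (rule lattice_basis_coordinates[OF v]) (rule that)
  define y where "y = (\<lambda>k :: nat. \<Sum>i<n. frac (\<kappa> i (of_nat k *\<^sub>R a)) *\<^sub>R v i)"
  \<comment> \<open>\<open>f k\<close> is the integral part of \<open>k a\<close> and \<open>y k\<close> its fractional part.\<close>
  define f where "f = (\<lambda>k :: nat. \<Sum>i<n. of_int \<lfloor>\<kappa> i (of_nat k *\<^sub>R a)\<rfloor> *\<^sub>R v i)"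
  have fL: "f k \<in> L" for k
    unfolding f_def lattice_basis_mem[OF v]
    by (rule exI[of _ "\<lambda>i. \<lfloor>\<kappa> i (of_nat k *\<^sub>R a)\<rfloor>"]) simp
  have y: "y k = of_nat k *\<^sub>R a - f k" for k
    unfolding y_def f_def frac_def scaleR_diff_left sum_subtractf
    using expand[OF span_scale[OF a, of "of_nat k"]] by simp
  have "y k \<in> layered L a" for k
    using layered_mem[OF lattice_basis_uminus[OF v fL], of k "int k" a] by (simp add: y)
  moreover have "norm (y k) \<le> (\<Sum>i<n. norm (v i))" for k
    unfolding y_def
    by (intro sum_norm_le) (auto simp: abs_of_nonneg less_imp_le[OF frac_lt_1] intro!: mult_left_le_one_le)
  ultimately have sub: "range y \<subseteq> layered L a \<inter> cball 0 (\<Sum>i<n. norm (v i))"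
    by auto
  have "uniform_discrete (layered L a)"
    unfolding uniform_discrete_def
  proof (intro exI conjI ballI impI)
    fix p q assume pq: "p \<in> layered L a" "q \<in> layered L a" "dist p q < \<epsilon>"
    then show "p = q"
      using \<epsilon>(2)[OF layered_diff[OF v pq(1,2)]] by (force simp: dist_norm)
  qed (rule \<epsilon>)
  then have "finite (range y)"
    using sub uniform_discrete_finite_iff bounded_cball bounded_subset finite_subset
    by (metis inf_le1 inf_le2 uniform_discrete_subset)
  then have "\<not> inj y"
    using finite_imageD infinite_UNIV_nat by blast
  then obtain k l where kl: "y k = y l" "k < l"
    unfolding inj_on_def by (metis linorder_neqE_nat)
  then have "of_int (int l - int k) *\<^sub>R a = f l - f k"
    by (simp add: y algebra_simps)
  then have "of_int (int l - int k) *\<^sub>R a \<in> L"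
    using lattice_basis_diff[OF v fL fL] by metis
  with kl(2) show ?thesis
    by (intro exI[of _ "int l - int k"]) auto
qed

text \<open>This is where the emptiness of the sphere gives discreteness. For \<open>w\<close> in the group and a vertex
  \<open>u\<close>, neither \<open>u + w\<close> nor \<open>u - w\<close> is inside the sphere, so \<open>w \<bullet> (u - c)\<close> is of second order in \<open>w\<close>. The vectors
  \<open>z\<close> for which \<open>w \<bullet> z\<close> is of second order form a subspace, and the affine span of the
  vertices forces it to contain \<open>span L\<close>. Taking \<open>z = w\<close> in coordinates bounds \<open>(norm w)\<^sup>2\<close> by a multiple of
  \<open>(norm w)\<^sup>3\<close>.\<close>

lemma layered_separated_from_zero:
  fixes L :: "'a::euclidean_space set"
  assumes v: "lattice_basis n v L" and P: "affine hull P = span L" and PM: "P \<subseteq> layered L a \<inter> sphere c \<rho>"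
    and ball: "ball c \<rho> \<inter> layered L a = {}" and a: "a \<in> span L"
  shows "\<exists>\<epsilon>>0. \<forall>w\<in>layered L a. w \<noteq> 0 \<longrightarrow> \<epsilon> \<le> norm w"
proof -
  define M where "M = layered L a"
  have tangent: "\<bar>w \<bullet> (u - c)\<bar> \<le> (norm w)\<^sup>2 / 2" if w: "w \<in> M" and u: "u \<in> P" for w u
  proof -
    have "(norm (u - c))\<^sup>2 \<le> (norm (u - c + z))\<^sup>2" if "z \<in> M" for z
    proof -
      have "u + z \<in> M"
        using u PM that layered_add[OF v] by (auto simp: M_def)
      then have "\<rho> \<le> dist c (u + z)"
        using ball by (force simp: M_def)
      moreover have "\<rho> = dist c u"
        using u PM by auto
      ultimately show ?thesis
        by (intro power_mono) (auto simp: dist_norm norm_minus_commute algebra_simps)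
    qed
    from this[OF w] this[of "- w"]
    have "- (w \<bullet> (u - c)) \<le> (norm w)\<^sup>2 / 2" "w \<bullet> (u - c) \<le> (norm w)\<^sup>2 / 2"
      using w layered_uminus[OF v, of w a]
      by (auto simp: M_def power2_norm_eq_inner inner_add_left inner_add_right inner_diff_left inner_diff_right
          inner_commute algebra_simps)
    then show ?thesis
      by linarith
  qed
  define H where "H = {z. \<exists>K. \<forall>w\<in>M. \<bar>w \<bullet> z\<bar> \<le> K * (norm w)\<^sup>2}"
  have H: "subspace H"
    unfolding subspace_def
  proof (intro conjI ballI allI)
    show "0 \<in> H"
      unfolding H_def by (auto intro!: exI[of _ 0])
    fix x assume "x \<in> H"
    then obtain K where K: "\<And>w. w \<in> M \<Longrightarrow> \<bar>w \<bullet> x\<bar> \<le> K * (norm w)\<^sup>2"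
      unfolding H_def by blast
    have "\<bar>w \<bullet> (s *\<^sub>R x)\<bar> \<le> (\<bar>s\<bar> * K) * (norm w)\<^sup>2" if "w \<in> M" for w s
      using mult_left_mono[OF K[OF that], of "\<bar>s\<bar>"] by (simp add: abs_mult mult.assoc)
    then show "s *\<^sub>R x \<in> H" for s
      unfolding H_def by blast
    fix y assume "y \<in> H"
    then obtain K' where K': "\<And>w. w \<in> M \<Longrightarrow> \<bar>w \<bullet> y\<bar> \<le> K' * (norm w)\<^sup>2"
      unfolding H_def by blast
    have "\<bar>w \<bullet> (x + y)\<bar> \<le> (K + K') * (norm w)\<^sup>2" if "w \<in> M" for w
      using K[OF that] K'[OF that] abs_triangle_ineq[of "w \<bullet> x" "w \<bullet> y"]
      by (simp add: inner_add_right distrib_right)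
    then show "x + y \<in> H"
      unfolding H_def by blast
  qed
  have "u - c \<in> H" if "u \<in> P" for u
    unfolding H_def using tangent[OF _ that] by (auto intro!: exI[of _ "1/2"])
  then have "P \<subseteq> (+) c ` H"
    by (force intro!: image_eqI[of _ _ "_ - c"])
  then have sub: "span L \<subseteq> (+) c ` H"
    unfolding P[symmetric]
    by (intro hull_minimal affine_translation[THEN iffD1] subspace_imp_affine H)
  then obtain h where "0 = c + h" "h \<in> H"
    using span_zero[of L] by blast
  \<comment> \<open>The affine space \<open>c + H\<close> contains \<open>span L\<close>, in particular the origin, so the shift by \<open>c\<close> can be dropped.\<close>
  then have "0 - c \<in> H"
    by (simp add: add_eq_0_iff eq_commute[of 0])
  have "span L \<subseteq> H"
  proof
    fix z assume "z \<in> span L"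
    then obtain h where "z = c + h" "h \<in> H"
      using sub by blast
    then show "z \<in> H"
      using subspace_diff[OF H _ \<open>0 - c \<in> H\<close>, of h] by (simp add: add.commute)
  qed
  then have "v i \<in> H" if "i < n" for i
    using lattice_basis_vector[OF v that] span_base by blast
  then have "\<forall>i\<in>{..<n}. \<exists>K. \<forall>w\<in>M. \<bar>w \<bullet> v i\<bar> \<le> K * (norm w)\<^sup>2"
    unfolding H_def by blast
  then obtain K where K: "\<And>i w. i < n \<Longrightarrow> w \<in> M \<Longrightarrow> \<bar>w \<bullet> v i\<bar> \<le> K i * (norm w)\<^sup>2"
    by (metis lessThan_iff)
  obtain \<kappa> :: "nat \<Rightarrow> 'a \<Rightarrow> real" where lin: "\<And>i. linear (\<kappa> i)"
    and coord: "\<And>(x :: nat \<Rightarrow> real) i. i < n \<Longrightarrow> \<kappa> i (\<Sum>j<n. x j *\<^sub>R v j) = x i"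
    and expand: "\<And>z. z \<in> span L \<Longrightarrow> (\<Sum>i<n. \<kappa> i z *\<^sub>R v i) = z"
    by (rule lattice_basis_coordinates[OF v]) (rule that)
  have "\<exists>C. \<forall>z. \<bar>\<kappa> i z\<bar> \<le> C * norm z" for i
    using linear_bounded[OF lin[of i]] by simp
  then obtain C where C: "\<And>i z. \<bar>\<kappa> i z\<bar> \<le> C i * norm z"
    by metis
  define S where "S = (\<Sum>i<n. \<bar>C i\<bar> * \<bar>K i\<bar>)"
  have MsL: "M \<subseteq> span L"
    unfolding M_def layered_def using a by (auto intro!: span_add span_scale intro: span_base)
  have "1 / (S + 1) \<le> norm w" if w: "w \<in> M" "w \<noteq> 0" for w
  proof -
    have "(norm w)\<^sup>2 = w \<bullet> (\<Sum>i<n. \<kappa> i w *\<^sub>R v i)"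
      using expand[of w] MsL w(1) by (auto simp: power2_norm_eq_inner)
    also have "\<dots> = (\<Sum>i<n. \<kappa> i w * (w \<bullet> v i))"
      by (simp add: inner_sum_right)
    also have "\<dots> \<le> (\<Sum>i<n. (\<bar>C i\<bar> * norm w) * (\<bar>K i\<bar> * (norm w)\<^sup>2))"
    proof (rule sum_mono)
      fix i assume i: "i \<in> {..<n}"
      have "\<bar>\<kappa> i w\<bar> \<le> \<bar>C i\<bar> * norm w"
        using C[of i w] mult_right_mono[OF abs_ge_self norm_ge_zero, of "C i" w] by linarith
      moreover have "\<bar>w \<bullet> v i\<bar> \<le> \<bar>K i\<bar> * (norm w)\<^sup>2"
        using K[of i w] i w(1) mult_right_mono[OF abs_ge_self zero_le_power2, of "K i" "norm w"] by force
      ultimately have "\<bar>\<kappa> i w\<bar> * \<bar>w \<bullet> v i\<bar> \<le> (\<bar>C i\<bar> * norm w) * (\<bar>K i\<bar> * (norm w)\<^sup>2)"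
        by (intro mult_mono) auto
      then show "\<kappa> i w * (w \<bullet> v i) \<le> (\<bar>C i\<bar> * norm w) * (\<bar>K i\<bar> * (norm w)\<^sup>2)"
        using abs_ge_self[of "\<kappa> i w * (w \<bullet> v i)"] by (simp add: abs_mult)
    qed
    also have "\<dots> = (S * norm w) * (norm w)\<^sup>2"
      unfolding S_def sum_distrib_right by (intro sum.cong refl) (simp add: mult_ac)
    finally have "1 \<le> S * norm w"
      using w(2) by simp
    then have "1 \<le> (S + 1) * norm w"
      by (simp add: distrib_right add_increasing2)
    moreover have "S \<ge> 0"
      unfolding S_def by (intro sum_nonneg) auto
    ultimately show ?thesis
      by (simp add: divide_simps mult.commute)
  qed
  moreover have "S \<ge> 0"
    unfolding S_def by (intro sum_nonneg) auto
  ultimately show ?thesis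
    by (intro exI[of _ "1 / (S + 1)"]) (auto simp: M_def)
qed

lemma coset_eq_iff:
  assumes v: "lattice_basis n v L"
  shows "(\<lambda>y. x + y) ` L = (\<lambda>y. x' + y) ` L \<longleftrightarrow> x - x' \<in> L"
proof
  assume "(\<lambda>y. x + y) ` L = (\<lambda>y. x' + y) ` L"
  moreover have "x \<in> (\<lambda>y. x + y) ` L"
    using lattice_basis_zero[OF v] by force
  ultimately obtain y where "x = x' + y" "y \<in> L"
    by blast
  then show "x - x' \<in> L"
    by simp
next
  have sub: "(\<lambda>y. x + y) ` L \<subseteq> (\<lambda>y. x' + y) ` L" if "x - x' \<in> L" for x x'
    using lattice_basis_add[OF v that] by (force intro!: image_eqI[of _ _ "x - x' + _"])
  assume "x - x' \<in> L"
  then show "(\<lambda>y. x + y) ` L = (\<lambda>y. x' + y) ` L"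
    using sub[of x x'] sub[of x' x] lattice_basis_uminus[OF v, of "x - x'"] by auto
qed

text \<open>The quotient is the cyclic group generated by the class of \<open>a\<close>, so its order is
  read off from the multiples of \<open>a\<close> that lie in \<open>L\<close>.\<close>

lemma layered_index:
  assumes v: "lattice_basis n v L" and m: "m > 0" "of_int m *\<^sub>R a \<in> L"
  shows "lattice_index L (layered L a) > 0"
    and "lattice_index L (layered L a) = 2 \<longleftrightarrow> a \<notin> L \<and> 2 *\<^sub>R a \<in> L"
proof -
  define coset where "coset = (\<lambda>x. (\<lambda>y. x + y) ` L)"
  have coset_eq: "coset x = coset x' \<longleftrightarrow> x - x' \<in> L" for x x'
    unfolding coset_def by (rule coset_eq_iff[OF v])
  define Q where "Q = coset ` layered L a"
  have index: "lattice_index L (layered L a) = card Q"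
    unfolding lattice_index_def Q_def coset_def by (rule arg_cong[of _ _ card]) auto
  have multiples: "Q = range (\<lambda>k :: int. coset (of_int k *\<^sub>R a))"
  proof (intro equalityI subsetI)
    fix q assume "q \<in> Q"
    then obtain x k where "q = coset (x + of_int k *\<^sub>R a)" "x \<in> L"
      unfolding Q_def layered_def by blast
    then have "q = coset (of_int k *\<^sub>R a)"
      by (simp add: coset_eq)
    then show "q \<in> range (\<lambda>k :: int. coset (of_int k *\<^sub>R a))"
      by blast
  next
    fix q assume "q \<in> range (\<lambda>k :: int. coset (of_int k *\<^sub>R a))"
    then show "q \<in> Q"
      using layered_mem[OF lattice_basis_zero[OF v]] by (force simp: Q_def)
  qed
  have "coset (of_int k *\<^sub>R a) = coset (of_int (k mod m) *\<^sub>R a)" for k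
  proof -
    have "of_int k *\<^sub>R a - of_int (k mod m) *\<^sub>R a = of_int (k div m * m) *\<^sub>R a"
      by (metis minus_mod_eq_div_mult of_int_diff scaleR_diff_left)
    also have "\<dots> = of_int (k div m) *\<^sub>R of_int m *\<^sub>R a"
      by simp
    finally show ?thesis
      using lattice_basis_of_int[OF v m(2)] by (simp add: coset_eq)
  qed
  then have "Q \<subseteq> (\<lambda>k. coset (of_int k *\<^sub>R a)) ` {0..<m}"
    unfolding multiples using m(1) by (auto intro!: image_eqI[of _ _ "_ mod m"])
  then have fin: "finite Q"
    using finite_surj by blast
  then show "lattice_index L (layered L a) > 0"
    unfolding index multiples by (simp add: card_gt_0_iff)
  have in_Q: "coset (of_int k *\<^sub>R a) \<in> Q" for k :: int
    unfolding multiples by blast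
  have three: "coset 0 \<in> Q" "coset a \<in> Q" "coset (2 *\<^sub>R a) \<in> Q"
    using in_Q[of 0] in_Q[of 1] in_Q[of 2] by simp_all
  show "lattice_index L (layered L a) = 2 \<longleftrightarrow> a \<notin> L \<and> 2 *\<^sub>R a \<in> L"
  proof
    assume "lattice_index L (layered L a) = 2"
    then have Q2: "card Q = 2"
      by (simp add: index)
    have aL: "a \<notin> L"
    proof
      assume "a \<in> L"
      then have "of_int k *\<^sub>R a \<in> L" for k
        by (rule lattice_basis_of_int[OF v])
      then have "coset (of_int k *\<^sub>R a) = coset 0" for k
        by (simp add: coset_eq)
      then have "Q = {coset 0}"
        unfolding multiples by auto
      with Q2 show False
        by simp
    qed
    then have "coset a \<noteq> coset 0"
      by (simp add: coset_eq)
    then have "Q = {coset 0, coset a}"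
      using card_subset_eq[OF fin, of "{coset 0, coset a}"] three Q2 by auto
    then have "coset (2 *\<^sub>R a) = coset 0 \<or> coset (2 *\<^sub>R a) = coset a"
      using three by blast
    then show "a \<notin> L \<and> 2 *\<^sub>R a \<in> L"
      using aL by (auto simp: coset_eq scaleR_2)
  next
    assume a: "a \<notin> L \<and> 2 *\<^sub>R a \<in> L"
    have "coset (of_int k *\<^sub>R a) \<in> {coset 0, coset a}" for k
    proof -
      have even: "of_int (2 * j) *\<^sub>R a \<in> L" for j
        using lattice_basis_of_int[OF v, of "2 *\<^sub>R a" j] a by (simp add: mult.commute)
      show ?thesis
      proof (cases "even k")
        case True
        then show ?thesis
          using even by (auto simp: coset_eq)
      next
        case False
        then obtain j where "k = 2 * j + 1"
          by (elim oddE)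
        then show ?thesis
          using even[of j] by (simp add: coset_eq algebra_simps)
      qed
    qed
    then have "Q = {coset 0, coset a}"
      unfolding multiples using three multiples by auto
    moreover have "coset 0 \<noteq> coset a"
      using a coset_eq[of a 0] by auto
    ultimately show "lattice_index L (layered L a) = 2"
      by (simp add: index)
  qed
qed

section \<open>The two cases of the theorem\<close>

text \<open>Each index \<open>k\<close> other than 0 and 1 imposes the lower bound \<open>((r 0)\<^sup>2 - (r k)\<^sup>2) / (k(k - 1))\<close> on \<open>\<delta>\<close>.
  These bounds are at most \<open>(r 0)\<^sup>2 / (k(k - 1))\<close>, which tends to 0, and some bound is positive, so a largest one exists.\<close>

lemma critical_height_exists:
  fixes r :: "int \<Rightarrow> real"
  assumes r: "\<And>k. r k \<ge> 0" and r1: "r 1 = r 0" and ex: "\<exists>i. r i < r 0"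
  shows "\<exists>\<delta>>0. (\<forall>k. (r 0)\<^sup>2 \<le> (r k)\<^sup>2 + of_int (k * (k - 1)) * \<delta>) \<and>
           (\<exists>k. k \<noteq> 0 \<and> k \<noteq> 1 \<and> (r 0)\<^sup>2 = (r k)\<^sup>2 + of_int (k * (k - 1)) * \<delta>)"
proof -
  define s :: "int \<Rightarrow> real" where "s = (\<lambda>k. of_int (k * (k - 1)))"
  define q where "q = (\<lambda>k. ((r 0)\<^sup>2 - (r k)\<^sup>2) / s k)"
  \<comment> \<open>A linear lower bound for \<open>s\<close> is enough to confine the competitors to a finite range.\<close>
  have growth: "of_int \<bar>k\<bar> - 1 \<le> s k" for k
  proof -
    have "\<bar>k\<bar> - 1 \<le> k * (k - 1)"
    proof (cases "k \<ge> 1")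
      case True
      then show ?thesis
        using mult_right_mono[of 1 k "k - 1"] by simp
    next
      case False
      then have "- k * 1 \<le> - k * (1 - k)"
        by (intro mult_left_mono) auto
      moreover have "- k * (1 - k) = k * (k - 1)"
        by (simp add: algebra_simps)
      ultimately show ?thesis
        using False by linarith
    qed
    then show ?thesis
      unfolding s_def by linarith
  qed
  have spos: "s k > 0" if "k \<noteq> 0" "k \<noteq> 1" for k
  proof -
    have "k \<ge> 2 \<or> k < 0"
      using that by linarith
    then have "k * (k - 1) > 0"
      by (auto intro: mult_pos_pos mult_neg_neg)
    then show ?thesis
      unfolding s_def by linarith
  qed
  obtain k0 where k0: "r k0 < r 0"
    using ex by blast
  then have k0': "k0 \<noteq> 0" "k0 \<noteq> 1"
    using r1 by auto
  have "(r k0)\<^sup>2 < (r 0)\<^sup>2"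
    using k0 r[of k0] by (intro power_strict_mono) auto
  then have q0: "q k0 > 0"
    using spos[OF k0'] by (simp add: q_def)
  define A where "A = {k. k \<noteq> 0 \<and> k \<noteq> 1 \<and> q k0 \<le> q k}"
  define N where "N = \<lceil>(r 0)\<^sup>2 / q k0\<rceil> + 1"
  have "A \<subseteq> {- N..N}"
  proof
    fix k assume k: "k \<in> A"
    have "q k0 * s k \<le> q k * s k"
      using k spos[of k] by (intro mult_right_mono) (auto simp: A_def)
    also have "\<dots> \<le> (r 0)\<^sup>2"
      using k spos[of k] by (auto simp: A_def q_def)
    finally have "s k \<le> (r 0)\<^sup>2 / q k0"
      using q0 by (simp add: field_simps)
    then have "of_int \<bar>k\<bar> - 1 \<le> (r 0)\<^sup>2 / q k0"
      using growth[of k] by linarith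
    then have "\<bar>k\<bar> \<le> N"
      unfolding N_def by linarith
    then show "k \<in> {- N..N}"
      by auto
  qed
  then have fin: "finite A"
    by (rule finite_subset) auto
  have k0A: "k0 \<in> A"
    using k0' by (simp add: A_def)
  have "Max (q ` A) \<in> q ` A"
    using fin k0A by (intro Max_in) auto
  then obtain k1 where k1: "k1 \<in> A" "q k1 = Max (q ` A)"
    by auto
  have maxA: "q k \<le> q k1" if "k \<in> A" for k
    unfolding k1(2) using fin that by simp
  have max: "q k \<le> q k1" if "k \<noteq> 0" "k \<noteq> 1" for k
    using maxA[of k] maxA[OF k0A] that by (cases "k \<in> A") (auto simp: A_def)
  show ?thesis
  proof (intro exI conjI allI)
    show "q k1 > 0"
      using maxA[OF k0A] q0 by linarith
    show "(r 0)\<^sup>2 \<le> (r k)\<^sup>2 + of_int (k * (k - 1)) * q k1" for k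
    proof (cases "k = 0 \<or> k = 1")
      case True
      then show ?thesis
        using r1 by auto
    next
      case False
      then have "q k * s k \<le> q k1 * s k"
        using max[of k] spos[of k] by (intro mult_right_mono) auto
      moreover have "q k * s k = (r 0)\<^sup>2 - (r k)\<^sup>2"
        using False spos[of k] by (simp add: q_def)
      ultimately show ?thesis
        by (simp add: s_def mult.commute)
    qed
    show "k1 \<noteq> 0" "k1 \<noteq> 1"
      using k1 by (auto simp: A_def)
    then have "q k1 * s k1 = (r 0)\<^sup>2 - (r k1)\<^sup>2"
      using spos[of k1] by (simp add: q_def)
    then show "(r 0)\<^sup>2 = (r k1)\<^sup>2 + of_int (k1 * (k1 - 1)) * q k1"
      by (simp add: s_def mult.commute)
  qed
qed

text \<open>For the lattice this gives \<open>r 1 = r 0\<close>, because \<open>r 1\<close> is measured at \<open>- c\<close>.\<close>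

lemma infdist_uminus:
  fixes L :: "'a::real_normed_vector set"
  assumes "\<And>x. x \<in> L \<Longrightarrow> - x \<in> L"
  shows "infdist (- x) L = infdist x L"
proof -
  have "dist (- x) ` L = dist x ` L"
  proof -
    have sub: "dist (- x) ` L \<subseteq> dist x ` L" for x
    proof
      fix d assume "d \<in> dist (- x) ` L"
      then obtain y where "y \<in> L" "d = dist (- x) y"
        by blast
      then show "d \<in> dist x ` L"
        using assms by (intro image_eqI[of _ _ "- y"]) (auto simp: dist_norm norm_minus_commute algebra_simps)
    qed
    from sub[of x] sub[of "- x"] show ?thesis
      by auto
  qed
  then show ?thesis
    by (simp add: infdist_def)
qed

lemma lift_vector_exists:
  fixes L :: "'a::euclidean_space set"
  assumes "dim L < DIM('a)" "\<delta> > 0"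
  shows "\<exists>e. lift_vector L c \<delta> e"
proof -
  obtain h where h: "h \<noteq> 0" "\<And>y. y \<in> span L \<Longrightarrow> orthogonal h y"
    using orthogonal_to_subspace_exists[OF assms(1)] by metis
  define e where "e = 2 *\<^sub>R c - (sqrt \<delta> / norm h) *\<^sub>R h"
  have "2 *\<^sub>R c - e = (sqrt \<delta> / norm h) *\<^sub>R h"
    by (simp add: e_def)
  then have "lift_vector L c \<delta> e"
    using h assms(2) by (auto simp: lift_vector_def orthogonal_clauses power_mult_distrib)
  then show ?thesis
    by blast
qed

text \<open>The case \<open>\<delta> = 0\<close>. Both lattices span the same space, so nothing is lost by restricting quadratic functions.\<close>

lemma coplanar_superlattice:
  fixes L D :: "'a::euclidean_space set"
  assumes v: "lattice_basis n v L" and D: "delaunay_polytope L c D" and dimD: "aff_dim D = int n"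
    and ne: "vertices D \<noteq> {}"
    and far: "\<And>k :: int. infdist c L \<le> infdist ((1 - 2 * of_int k) *\<^sub>R c) L"
  defines "L' \<equiv> layered L (2 *\<^sub>R c)"
  defines "D' \<equiv> delaunay_at L' c"
  shows "is_lattice n L' \<and> L \<subseteq> L' \<and> lattice_index L L' > 0 \<and>
         (lattice_index L L' = 2 \<longleftrightarrow> 2 *\<^sub>R c \<notin> L \<and> 4 *\<^sub>R c \<in> L) \<and>
         delaunay_polytope L' c D' \<and> aff_dim D' = int n \<and> centrally_symmetric c D' \<and>
         D \<union> (\<lambda>x. 2 *\<^sub>R c - x) ` D \<subseteq> D' \<and>
         (\<forall>w. lattice_basis n w L' \<longrightarrow> perfrank n w D' \<le> perfrank n v D)"
proof -
  have c: "c \<in> span L"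
    using D by (simp add: delaunay_polytope_def)
  have a: "2 *\<^sub>R c \<in> span L"
    using c by (rule span_scale)
  have LL': "L \<subseteq> L'"
    unfolding L'_def by (rule layered_superset)
  have "L' \<subseteq> span L"
    unfolding L'_def layered_def using span_scale[OF a] span_base[of _ L] by (auto intro!: span_add simp del: scaleR_scaleR)
  then have span: "span L' = span L"
    using LL' by (metis span_mono span_span subset_antisym)
  have orth: "\<forall>z\<in>span L. orthogonal (2 *\<^sub>R c - 2 *\<^sub>R c) z"
    by (simp add: orthogonal_clauses)
  have far2: "(infdist c L)\<^sup>2 \<le> (infdist ((1 - 2 * of_int k) *\<^sub>R c) L)\<^sup>2
      + of_int (k * (k - 1)) * (norm (2 *\<^sub>R c - 2 *\<^sub>R c))\<^sup>2" for k :: int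
    using power_mono[OF far[of k] infdist_nonneg, of 2] by simp
  have vD: "vertices D = sphere c (infdist c L) \<inter> L"
    by (rule delaunay_infdist[OF v D ne])
  have "infdist c L \<le> dist c z" if z: "z \<in> L'" for z
  proof (rule power2_le_imp_le)
    show "(infdist c L)\<^sup>2 \<le> (dist c z)\<^sup>2"
      using layered_distance_ge[OF c orth far2 z[unfolded L'_def]] by simp
  qed simp
  then have ball: "ball c (infdist c L) \<inter> layered L (2 *\<^sub>R c) = {}"
    by (force simp: L'_def)
  have "vertices D \<subseteq> layered L (2 *\<^sub>R c) \<inter> sphere c (infdist c L)"
    using vD LL' by (auto simp: L'_def)
  then obtain \<epsilon> where \<epsilon>: "\<epsilon> > 0" "\<And>w. w \<in> layered L (2 *\<^sub>R c) \<Longrightarrow> w \<noteq> 0 \<Longrightarrow> \<epsilon> \<le> norm w"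
    using layered_separated_from_zero[OF v delaunay_affine_hull(1)[OF v D dimD] _ ball a] by blast
  obtain m :: int where m: "m > 0" "of_int m *\<^sub>R (2 *\<^sub>R c) \<in> L"
    using multiple_in_lattice[OF v a \<epsilon>] by blast
  have "is_lattice n L'"
  proof (rule superlattice_basis_exists[OF v _ _ LL' m(1)])
    fix z assume "z \<in> L'"
    then obtain x k where z: "z = x + of_int k *\<^sub>R (2 *\<^sub>R c)" "x \<in> L"
      unfolding L'_def layered_def by blast
    have "of_int m *\<^sub>R z = of_int m *\<^sub>R x + of_int k *\<^sub>R (of_int m *\<^sub>R (2 *\<^sub>R c))"
      by (simp add: z(1) scaleR_add_right mult.left_commute)
    also have "\<dots> \<in> L"
      by (rule lattice_basis_add[OF v lattice_basis_of_int[OF v z(2)] lattice_basis_of_int[OF v m(2)]])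
    finally show "of_int m *\<^sub>R z \<in> L" .
  qed (auto simp: L'_def intro: layered_add[OF v] layered_uminus[OF v])
  then obtain w where w: "lattice_basis n w (layered L (2 *\<^sub>R c))"
    by (auto simp: is_lattice_def L'_def)
  have half: "(1 / 2) *\<^sub>R 2 *\<^sub>R c = c"
    by simp
  note L'D' = layered_delaunay[OF v D ne orth w far2, unfolded half, folded L'_def, folded D'_def]
  have pL': "vertices D' \<subseteq> L'"
    using L'D'(1) by (auto simp: delaunay_polytope_def)
  have "D' = convex hull (vertices D')"
    using L'D'(1) by (intro polytope_convex_hull_vertices) (simp add: delaunay_polytope_def)
  also have "\<dots> \<subseteq> span L"
    using pL' \<open>L' \<subseteq> span L\<close> by (intro hull_minimal subspace_imp_convex) auto
  finally have "aff_dim D' \<le> int n"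
    using aff_dim_subset[of D' "span L"] lattice_basis_dim[OF v] by (simp add: aff_dim_subspace)
  moreover have "int n \<le> aff_dim D'"
    using aff_dim_subset[of D D'] L'D'(6) dimD by simp
  ultimately have "aff_dim D' = int n"
    by simp
  moreover have "perfrank n w D' \<le> perfrank n v D" if "lattice_basis n w L'" for w
    by (rule perfrank_le_of_restriction_injective[OF v D that L'D'(1) LL' L'D'(3)]) (simp add: span)
  moreover have "lattice_index L L' = 2 \<longleftrightarrow> 2 *\<^sub>R c \<notin> L \<and> 4 *\<^sub>R c \<in> L"
    using layered_index(2)[OF v m] by (simp add: L'_def)
  ultimately show ?thesis
    using \<open>is_lattice n L'\<close> LL' layered_index(1)[OF v m] L'D' by (auto simp: L'_def)
qed

text \<open>The layer \<open>k\<close>, whose distance to \<open>e/2\<close> equals that of the layers 0 and 1, contributes the vertex that lies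
  outside \<open>span L\<close> and that makes the restriction of quadratic functions injective.\<close>

lemma lifted_superlattice:
  fixes L D :: "'a::euclidean_space set"
  assumes v: "lattice_basis n v L" and D: "delaunay_polytope L c D" and dimD: "aff_dim D = int n"
    and ne: "vertices D \<noteq> {}" and dim: "DIM('a) = n + 1"
    and \<delta>: "\<delta> > 0" and e: "lift_vector L c \<delta> e"
    and far: "\<And>k :: int. (infdist c L)\<^sup>2 \<le> (infdist ((1 - 2 * of_int k) *\<^sub>R c) L)\<^sup>2 + of_int (k * (k - 1)) * \<delta>"
    and k: "k \<noteq> 0" "k \<noteq> 1"
    and touch: "(infdist c L)\<^sup>2 = (infdist ((1 - 2 * of_int k) *\<^sub>R c) L)\<^sup>2 + of_int (k * (k - 1)) * \<delta>"
  defines "L' \<equiv> layered L e" and "c' \<equiv> (1/2) *\<^sub>R e"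
  defines "D' \<equiv> delaunay_at L' c'"
  shows "is_lattice (n + 1) L' \<and>
         delaunay_polytope L' c' D' \<and> aff_dim D' = int (n + 1) \<and> centrally_symmetric c' D' \<and>
         D \<union> (\<lambda>x. 2 *\<^sub>R c' - x) ` D \<subseteq> D' \<and>
         (\<forall>w. lattice_basis (n + 1) w L' \<longrightarrow> perfrank (n + 1) w D' \<le> perfrank n v D)"
proof -
  have c: "c \<in> span L"
    using D by (simp add: delaunay_polytope_def)
  have orth: "\<forall>z\<in>span L. orthogonal (2 *\<^sub>R c - e) z"
    using e by (simp add: lift_vector_def)
  have norm: "(norm (2 *\<^sub>R c - e))\<^sup>2 = \<delta>"
    using e by (simp add: lift_vector_def)
  have eL: "e \<notin> span L"
  proof
    assume "e \<in> span L"
    then have "2 *\<^sub>R c - e \<in> span L"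
      using c by (intro span_diff span_scale)
    with orth have "orthogonal (2 *\<^sub>R c - e) (2 *\<^sub>R c - e)"
      by blast
    then show False
      using norm \<delta> by (simp add: orthogonal_self)
  qed
  note w = layered_lattice_basis[OF v eL]
  note L'D' = layered_delaunay[OF v D ne orth w, unfolded norm, OF far, folded L'_def c'_def, folded D'_def]
  obtain x where x: "x \<in> L" "dist ((1 - 2 * of_int k) *\<^sub>R c) x = infdist ((1 - 2 * of_int k) *\<^sub>R c) L"
    using delaunay_radius_eq_infdist(2)[OF v] by blast
  define p where "p = x + of_int k *\<^sub>R e"
  have "(dist c' p)\<^sup>2 = (infdist c L)\<^sup>2 + \<delta> / 4"
    unfolding c'_def p_def layered_distance[OF c span_base[OF x(1)] orth] norm x(2) touch
    by (simp add: power2_eq_square field_simps)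
  then have p: "p \<in> vertices D'"
    using x(1) by (simp add: L'D'(2) L'_def p_def layered_mem)
  have pL: "p \<notin> span L"
  proof
    assume "p \<in> span L"
    then have "(1 / of_int k) *\<^sub>R (p - x) \<in> span L"
      using x(1) by (intro span_scale span_diff) (auto intro: span_base)
    then show False
      using eL k by (simp add: p_def)
  qed
  have "p \<in> D'"
    using p by (simp add: vertices_def extreme_point_of_def)
  then have "insert p D \<subseteq> D'"
    using L'D'(6) by simp
  moreover have "aff_dim (insert p D) = int (n + 1)"
    using pL dimD by (simp add: aff_dim_insert delaunay_affine_hull(2)[OF v D dimD])
  ultimately have "aff_dim D' = int (n + 1)"
    using aff_dim_subset[of "insert p D" D'] aff_dim_le_DIM[of D'] dim by simp
  moreover have "perfrank (n + 1) w D' \<le> perfrank n v D" if w': "lattice_basis (n + 1) w L'" for w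
  proof (rule perfrank_le_of_restriction_injective[OF v D w' L'D'(1) _ L'D'(3)])
    show "L \<subseteq> L'"
      unfolding L'_def by (rule layered_superset)
    fix F z
    assume F: "is_quadratic F" and FD': "\<And>z. z \<in> vertices D' \<Longrightarrow> F z = 0"
      and FL: "\<And>z. z \<in> span L \<Longrightarrow> F z = 0" and z: "z \<in> span L'"
    show "F z = 0"
    proof (rule is_quadratic_vanishes_of_three_layers[OF F FL delaunay_affine_hull(1)[OF v D dimD] _ _ k])
      show "F (e - u) = 0" if "u \<in> vertices D" for u
        using FD' L'D'(3,4) that by blast
      show "F (x + of_int k *\<^sub>R e) = 0"
        using FD'[OF p] by (simp add: p_def)
    qed (use z x in \<open>auto simp: L'_def span_base\<close>)
  qed
  moreover have "is_lattice (n + 1) L'"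
    unfolding is_lattice_def L'_def using w by blast
  ultimately show ?thesis
    using L'D' by blast
qed

theorem theorem3:
  fixes L D :: "'a::euclidean_space set" and c :: 'a and n :: nat and v :: "nat \<Rightarrow> 'a"
    and r :: "int \<Rightarrow> real"
  defines "r \<equiv> \<lambda>i. delaunay_radius L ((1 - 2 * of_int i) *\<^sub>R c)"
  assumes "DIM('a) = n + 1"
    and "lattice_basis n v L"
    and "delaunay_polytope L c D"
    and "aff_dim D = int n"
  shows
    "((\<forall>i. r i \<ge> r 0) \<and>
      (let L' = layered L (2 *\<^sub>R c); D' = delaunay_at L' c in
         is_lattice n L' \<and> L \<subseteq> L' \<and> lattice_index L L' > 0 \<and>
         (lattice_index L L' = 2 \<longleftrightarrow> 2 *\<^sub>R c \<notin> L \<and> 4 *\<^sub>R c \<in> L) \<and>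
         delaunay_polytope L' c D' \<and> aff_dim D' = int n \<and> centrally_symmetric c D' \<and>
         D \<union> (\<lambda>x. 2 *\<^sub>R c - x) ` D \<subseteq> D' \<and>
         (\<forall>w. lattice_basis n w L' \<longrightarrow> perfrank n w D' \<le> perfrank n v D)))
     \<or>
     ((\<exists>i. r i < r 0) \<and>
      (\<exists>\<delta>>0. (\<exists>e. lift_vector L c \<delta> e) \<and>
        (\<forall>e. lift_vector L c \<delta> e \<longrightarrow>
          (let L' = layered L e; c' = (1/2) *\<^sub>R e; D' = delaunay_at L' c' in
             is_lattice (n + 1) L' \<and>
             delaunay_polytope L' c' D' \<and> aff_dim D' = int (n + 1) \<and> centrally_symmetric c' D' \<and>
             D \<union> (\<lambda>x. 2 *\<^sub>R c' - x) ` D \<subseteq> D' \<and>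
             (\<forall>w. lattice_basis (n + 1) w L' \<longrightarrow> perfrank (n + 1) w D' \<le> perfrank n v D)))))"
proof -
  note v = assms(3) and D = assms(4) and dimD = assms(5)
  have r: "r i = infdist ((1 - 2 * of_int i) *\<^sub>R c) L" for i
    unfolding r_def by (rule delaunay_radius_eq_infdist(1)[OF v])
  have r0: "infdist c L = r 0"
    by (simp add: r)
  have "affine hull (vertices D) \<noteq> {}"
    using delaunay_affine_hull(1)[OF v D dimD] span_zero[of L] by auto
  then have ne: "vertices D \<noteq> {}"
    by simp
  show ?thesis
  proof (cases "\<forall>i. r i \<ge> r 0")
    case True
    then have "infdist c L \<le> infdist ((1 - 2 * of_int k) *\<^sub>R c) L" for k :: int
      by (simp add: r0 flip: r)
    from coplanar_superlattice[OF v D dimD ne this] True show ?thesis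
      unfolding Let_def by blast
  next
    case False
    then have lower: "\<exists>i. r i < r 0"
      by (auto simp: not_le)
    have "r 1 = r 0"
      using infdist_uminus[OF lattice_basis_uminus[OF v], of c] by (simp add: r)
    then obtain \<delta> k where \<delta>: "\<delta> > 0" and far: "\<And>k. (r 0)\<^sup>2 \<le> (r k)\<^sup>2 + of_int (k * (k - 1)) * \<delta>"
      and k: "k \<noteq> 0" "k \<noteq> 1" and touch: "(r 0)\<^sup>2 = (r k)\<^sup>2 + of_int (k * (k - 1)) * \<delta>"
      using critical_height_exists[of r] lower infdist_nonneg r by metis
    have "\<exists>e. lift_vector L c \<delta> e"
      using lattice_basis_dim[OF v] assms(2) \<delta> by (intro lift_vector_exists) auto
    moreover note lifted_superlattice[OF v D dimD ne assms(2) \<delta> _ far[folded r0, unfolded r] k touch[folded r0, unfolded r]]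
    ultimately show ?thesis
      using lower \<delta> unfolding Let_def by blast
  qed
qed

end
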